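(* Let $\mathbb{K}$ be a field and let $\mathcal{F}:\mathbb{P}^1_{\mathbb{K}}\times\mathbb{P}^1_{\mathbb{K}}\dashrightarrow\mathbb{P}^2_{\mathbb{K}}$ be a dominant rational map defined by bi-homogeneous polynomials $f_0,f_1,f_2\in R$ of the same bi-degree $\mathbf{d}=(1,d_2)$, with base ideal $I=(f_0,f_1,f_2)$ and base locus $\mathcal{B}=V(I)\subset\mathbb{P}^1\times\mathbb{P}^1$ such that $\dim(\mathcal{B})=0$. Then $\mathcal{F}$ is birational if and only if $I_{\mathbf{d}}=[I^{\mathrm{sat}}]_{\mathbf{d}}$.
   Context: $R=\mathbb{K}[x_{1,0},x_{1,1}]\otimes_{\mathbb{K}}\mathbb{K}[x_{2,0},x_{2,1}]$ is the bigraded coordinate ring of $\mathbb{P}^1\times\mathbb{P}^1$, $\mathfrak{N}=\bigoplus_{j_1>0,j_2>0}R_{j_1,j_2}$, $I^{\mathrm{sat}}=(I:\mathfrak{N}^\infty)$, and the subscript $\mathbf{d}$ denotes the component of bi-degree $\mathbf{d}$. $\mathcal{F}$ is birational if it is dominant with an inverse rational map. $\dim(\mathcal{B})=0$ means that $\mathcal{B}$ is finite over $\mathbb{K}$. *)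

theory Defs
  imports Complex_Main "HOL-Library.Poly_Mapping"
begin

section \<open>Polynomial rings\<close>

text \<open>
  The polynomial ring over \<open>'k\<close> with one variable for each element of \<open>'v\<close> is the monoid
  algebra of the monoid \<open>'v \<Rightarrow>\<^sub>0 nat\<close> of monomials.
\<close>

type_synonym ('v, 'k) mpoly = "('v \<Rightarrow>\<^sub>0 nat) \<Rightarrow>\<^sub>0 'k"

definition Const :: "'k::comm_ring_1 \<Rightarrow> ('v, 'k) mpoly" where
  "Const c = Poly_Mapping.single 0 c"

definition Var :: "'v \<Rightarrow> ('v, 'k::comm_ring_1) mpoly" where
  "Var v = Poly_Mapping.single (Poly_Mapping.single v 1) 1"

text \<open>\<open>subst \<sigma>\<close> is the \<open>'k\<close>-algebra homomorphism sending the variable \<open>v\<close> to \<open>\<sigma> v\<close>.\<close>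

definition subst :: "('v \<Rightarrow> ('w, 'k::comm_ring_1) mpoly) \<Rightarrow> ('v, 'k) mpoly \<Rightarrow> ('w, 'k) mpoly" where
  "subst \<sigma> p = (\<Sum>m\<in>Poly_Mapping.keys p. Const (Poly_Mapping.lookup p m) *
      (\<Prod>v\<in>Poly_Mapping.keys m. \<sigma> v ^ Poly_Mapping.lookup m v))"

text \<open>
  Gradings are given by a function \<open>deg\<close> on monomials, with values in \<open>nat\<close> (total degree) or in
  \<open>nat \<times> nat\<close> (bi-degree). The zero polynomial is homogeneous of every degree.
\<close>

definition homog :: "(('v \<Rightarrow>\<^sub>0 nat) \<Rightarrow> 'g) \<Rightarrow> 'g \<Rightarrow> ('v, 'k::zero) mpoly \<Rightarrow> bool" where
  "homog deg d p \<longleftrightarrow> (\<forall>m\<in>Poly_Mapping.keys p. deg m = d)"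

section \<open>Ideals\<close>

abbreviation is_ideal :: "'r::comm_ring_1 set \<Rightarrow> bool" where
  "is_ideal \<equiv> module.subspace (*)"

abbreviation ideal_gen :: "'r::comm_ring_1 set \<Rightarrow> 'r set" where
  "ideal_gen \<equiv> module.span (*)"

definition prime_ideal :: "'r::comm_ring_1 set \<Rightarrow> bool" where
  "prime_ideal P \<longleftrightarrow> is_ideal P \<and> P \<noteq> UNIV \<and> (\<forall>a b. a * b \<in> P \<longrightarrow> a \<in> P \<or> b \<in> P)"

definition homog_ideal :: "(('v \<Rightarrow>\<^sub>0 nat) \<Rightarrow> 'g) \<Rightarrow> ('v, 'k::comm_ring_1) mpoly set \<Rightarrow> bool" where
  "homog_ideal deg J \<longleftrightarrow> is_ideal J \<and> J = ideal_gen {p \<in> J. \<exists>d. homog deg d p}"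

primrec ideal_pow :: "'r::comm_ring_1 set \<Rightarrow> nat \<Rightarrow> 'r set" where
  "ideal_pow J 0 = UNIV"
| "ideal_pow J (Suc n) = ideal_gen {a * b | a b. a \<in> J \<and> b \<in> ideal_pow J n}"

definition colon :: "'r::comm_ring_1 set \<Rightarrow> 'r set \<Rightarrow> 'r set" where
  "colon I J = {h. \<forall>g\<in>J. h * g \<in> I}"

definition saturation :: "'r::comm_ring_1 set \<Rightarrow> 'r set \<Rightarrow> 'r set" where
  "saturation I J = (\<Union>n. colon I (ideal_pow J n))"

text \<open>The degree \<open>d\<close> component $[J]_d$ of a homogeneous ideal \<open>J\<close>.\<close>

definition component :: "(('v \<Rightarrow>\<^sub>0 nat) \<Rightarrow> 'g) \<Rightarrow> 'g \<Rightarrow> ('v, 'k::zero) mpoly set \<Rightarrow> ('v, 'k) mpoly set" where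
  "component deg d J = {p \<in> J. homog deg d p}"

section \<open>Coordinate rings of $\mathbb{P}^1\times\mathbb{P}^1$ and $\mathbb{P}^2$\<close>

text \<open>\<open>X10, X11, X20, X21\<close> stand for $x_{1,0}, x_{1,1}, x_{2,0}, x_{2,1}$.\<close>

datatype xvar = X10 | X11 | X20 | X21

datatype zvar = Z0 | Z1 | Z2

definition bideg :: "(xvar \<Rightarrow>\<^sub>0 nat) \<Rightarrow> nat \<times> nat" where
  "bideg m = (Poly_Mapping.lookup m X10 + Poly_Mapping.lookup m X11,
              Poly_Mapping.lookup m X20 + Poly_Mapping.lookup m X21)"

definition tdeg :: "(zvar \<Rightarrow>\<^sub>0 nat) \<Rightarrow> nat" where
  "tdeg m = Poly_Mapping.lookup m Z0 + Poly_Mapping.lookup m Z1 + Poly_Mapping.lookup m Z2"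

text \<open>$\mathfrak{N} = \bigoplus_{j_1>0,\,j_2>0} R_{j_1,j_2}$\<close>

definition irrelevant_x :: "(xvar, 'k::comm_ring_1) mpoly set" where
  "irrelevant_x = {p. \<forall>m\<in>Poly_Mapping.keys p. 0 < fst (bideg m) \<and> 0 < snd (bideg m)}"

definition irrelevant_z :: "(zvar, 'k::comm_ring_1) mpoly set" where
  "irrelevant_z = ideal_gen (range Var)"

text \<open>
  The points of the schemes $\mathbb{P}^1\times\mathbb{P}^1$ and $\mathbb{P}^2$ are the relevant
  (bi-)homogeneous primes; the Zariski closed sets are the sets \<open>V_x J\<close>, \<open>V_z J\<close>.
\<close>

definition P1xP1 :: "(xvar, 'k::comm_ring_1) mpoly set set" where
  "P1xP1 = {P. prime_ideal P \<and> homog_ideal bideg P \<and> \<not> irrelevant_x \<subseteq> P}"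

definition P2 :: "(zvar, 'k::comm_ring_1) mpoly set set" where
  "P2 = {Q. prime_ideal Q \<and> homog_ideal tdeg Q \<and> \<not> irrelevant_z \<subseteq> Q}"

definition V_x :: "(xvar, 'k::comm_ring_1) mpoly set \<Rightarrow> (xvar, 'k) mpoly set set" where
  "V_x J = {P \<in> P1xP1. J \<subseteq> P}"

definition V_z :: "(zvar, 'k::comm_ring_1) mpoly set \<Rightarrow> (zvar, 'k) mpoly set set" where
  "V_z J = {Q \<in> P2. J \<subseteq> Q}"

section \<open>The rational map given by $f_0, f_1, f_2$\<close>

definition base_ideal :: "(zvar \<Rightarrow> (xvar, 'k::comm_ring_1) mpoly) \<Rightarrow> (xvar, 'k) mpoly set" where
  "base_ideal f = ideal_gen {f Z0, f Z1, f Z2}"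

text \<open>
  The closed subscheme $V(I)$ of $\mathbb{P}^1\times\mathbb{P}^1$ is covered by its four affine
  charts $x_{1,i}\,x_{2,j} \neq 0$, whose coordinate rings are the dehomogenisations
  $R/(I, x_{1,i}-1, x_{2,j}-1)$. It is finite over $\mathbb{K}$ iff these four algebras are
  finite-dimensional vector spaces over $\mathbb{K}$: the charts are then finite and discrete,
  so that $V(I)$ is a finite disjoint union of spectra of finite-dimensional local algebras.
  As for any finite scheme, $V(I) = \emptyset$ is not excluded.
\<close>

abbreviation K_span :: "('v, 'k::comm_ring_1) mpoly set \<Rightarrow> ('v, 'k) mpoly set" where
  "K_span \<equiv> module.span (\<lambda>c p. Const c * p)"

definition quotient_finite_dim :: "('v, 'k::field) mpoly set \<Rightarrow> bool" where
  "quotient_finite_dim J \<longleftrightarrow> (\<exists>S. finite S \<and> K_span (S \<union> J) = UNIV)"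

definition zero_scheme_finite :: "(xvar, 'k::field) mpoly set \<Rightarrow> bool" where
  "zero_scheme_finite I \<longleftrightarrow> (\<forall>u\<in>{X10, X11}. \<forall>v\<in>{X20, X21}.
     quotient_finite_dim (ideal_gen (I \<union> {Var u - 1, Var v - 1})))"

text \<open>
  On points, the map sends a prime \<open>P\<close> outside the base locus to its preimage under
  $\mathbb{K}[z_0,z_1,z_2] \to R$, $z_i \mapsto f_i$.
\<close>

definition map_point ::
  "(zvar \<Rightarrow> (xvar, 'k::comm_ring_1) mpoly) \<Rightarrow> (xvar, 'k) mpoly set \<Rightarrow> (zvar, 'k) mpoly set" where
  "map_point f P = {h. subst f h \<in> P}"

definition dominant :: "(zvar \<Rightarrow> (xvar, 'k::comm_ring_1) mpoly) \<Rightarrow> bool" where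
  "dominant f \<longleftrightarrow>
     (\<forall>J. map_point f ` (P1xP1 - V_x (base_ideal f)) \<subseteq> V_z J \<longrightarrow> V_z J = P2)"

text \<open>
  Equality of rational maps into projective space that are given by tuples \<open>u\<close>, \<open>w\<close> of homogeneous
  coordinates indexed by \<open>A\<close>; both tuples have to be nonzero, i.e. have to define a rational map.
\<close>

definition same_coords :: "'i set \<Rightarrow> ('i \<Rightarrow> 'r::comm_ring_1) \<Rightarrow> ('i \<Rightarrow> 'r) \<Rightarrow> bool" where
  "same_coords A u w \<longleftrightarrow> (\<exists>i\<in>A. u i \<noteq> 0) \<and> (\<exists>i\<in>A. w i \<noteq> 0) \<and>
     (\<forall>i\<in>A. \<forall>j\<in>A. u i * w j = u j * w i)"

text \<open>
  A rational map $\mathbb{P}^2 \dashrightarrow \mathbb{P}^1\times\mathbb{P}^1$ is a pair of rational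
  maps $(g_{1,0}:g_{1,1})$, $(g_{2,0}:g_{2,1})$ to $\mathbb{P}^1$, each given by two forms of the
  same degree that are not both zero.
\<close>

definition rational_map_P2_P1xP1 :: "(xvar \<Rightarrow> (zvar, 'k::comm_ring_1) mpoly) \<Rightarrow> bool" where
  "rational_map_P2_P1xP1 g \<longleftrightarrow>
     (\<exists>e1. homog tdeg e1 (g X10) \<and> homog tdeg e1 (g X11)) \<and> (g X10 \<noteq> 0 \<or> g X11 \<noteq> 0) \<and>
     (\<exists>e2. homog tdeg e2 (g X20) \<and> homog tdeg e2 (g X21)) \<and> (g X20 \<noteq> 0 \<or> g X21 \<noteq> 0)"

text \<open>The composites $\mathcal{G}\circ\mathcal{F}$ and $\mathcal{F}\circ\mathcal{G}$ are defined
  and equal to the identity as rational maps.\<close>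

definition inverse_rational_map ::
  "(zvar \<Rightarrow> (xvar, 'k::comm_ring_1) mpoly) \<Rightarrow> (xvar \<Rightarrow> (zvar, 'k) mpoly) \<Rightarrow> bool" where
  "inverse_rational_map f g \<longleftrightarrow> rational_map_P2_P1xP1 g \<and>
     same_coords {X10, X11} (\<lambda>v. subst f (g v)) Var \<and>
     same_coords {X20, X21} (\<lambda>v. subst f (g v)) Var \<and>
     same_coords {Z0, Z1, Z2} (\<lambda>i. subst g (f i)) Var"

definition birational :: "(zvar \<Rightarrow> (xvar, 'k::comm_ring_1) mpoly) \<Rightarrow> bool" where
  "birational f \<longleftrightarrow> dominant f \<and> (\<exists>g. inverse_rational_map f g)"

end

theory Submission
  imports Defs "HOL-Computational_Algebra.Polynomial_Factorial" "HOL-Library.Product_Plus"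
begin

text \<open>
  Write $f_i = x_{1,0}\,a_i + x_{1,1}\,b_i$ with binary forms $a_i, b_i$ of degree $d = d_2$ in
  $y = (x_{2,0}, x_{2,1})$. For a fixed \<open>y\<close> the image of the line
  $\mathbb{P}^1 \times \{y\}$ is the line through the points $a(y)$ and $b(y)$ of the plane, so the
  map is a one-parameter family of lines. Such a family is described by a syzygy \<open>q\<close>: a vector of
  three binary forms in \<open>y\<close> without common factor such that $q \cdot a = q \cdot b = 0$. A point
  \<open>z\<close> of the plane lies on the line with parameter \<open>y\<close> iff $q(y) \cdot z = 0$, hence on as many
  lines of the family as the degree of \<open>q\<close> says. Thus the map is birational iff \<open>q\<close> is linear in
  \<open>y\<close>. The proof shows that each side of the theorem is equivalent to the existence of a nonzero
  syzygy $x_{2,1}\,u - x_{2,0}\,v$ with constant vectors \<open>u\<close>, \<open>v\<close>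
  (\<open>linear_syzygy\<close>). Binary forms are represented by their dehomogenisations at
  $x_{2,1} = 1$, which are polynomials in one variable \<open>Y\<close>, together with a degree bound.

  Dominance has two consequences. The substitution $z_i \mapsto f_i$ is injective
  (\<open>subst_injective_of_dominant\<close>), and the minors $a_i b_j - a_j b_i$ do not all vanish
  (\<open>minors_nonzero\<close>): otherwise the image is a rational curve, and counting dimensions gives an
  equation of this curve. Dividing the vector $a \times b$ by the gcd of its entries yields a syzygy
  \<open>q\<close> that is unimodular over $\mathbb{K}[Y]$ (\<open>unimodular_syzygy\<close>).

  \<^item> A saturated base ideal gives a linear syzygy (\<open>linear_syzygy_of_saturated\<close>). Let
  $u = q(0)$, up to sign. Then $u \cdot f$ vanishes at $Y = 0$, that is,
  $u \cdot f = x_{2,0} P'$. The form $P = x_{2,1} P'$ has bi-degree $(1, d)$ and lies in the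
  saturation, so it is a linear combination $v \cdot f$, and \<open>(u, v)\<close> is a linear syzygy.
  Behind this is the first cohomology of the line bundle on the projective line whose degree is minus
  that of \<open>q\<close>: it measures the excess of the saturation, and \<open>P\<close> is the image of a Cech cocycle.

  \<^item> An inverse gives a linear syzygy (\<open>linear_syzygy_of_inverse\<close>). The inverse expresses
  \<open>Y\<close> as a quotient of forms in \<open>z\<close>, so a polynomial $\gamma_0(z) - Y \gamma_1(z)$ vanishes on the
  plane $q \cdot z = 0$. As \<open>q\<close> is unimodular, $q \cdot z$ divides this polynomial, and
  comparing degrees in \<open>Y\<close> shows that \<open>q\<close> has degree at most one.

  \<^item> A linear syzygy gives a normal form (\<open>normal_form\<close>): after a linear change of coordinates
  in the plane, $f = (x_{2,0} h, x_{2,1} h, g)$ with \<open>h\<close> of bi-degree $(1, d - 1)$ and \<open>g\<close> of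
  bi-degree $(1, d)$. The inverse can be read off (\<open>inverse_of_linear_syzygy\<close>): \<open>y\<close> is
  $(z_0 : z_1)$, and then $(x_{1,0} : x_{1,1})$ solves a linear equation.

  \<^item> In the normal form the base ideal is saturated in bi-degree $(1, d)$
  (\<open>saturated_of_linear_syzygy\<close>). By Cramer's rule an element \<open>P\<close> of this bi-degree is
  $\alpha h + \beta g$, where \<open>\<alpha>\<close> and \<open>\<beta>\<close> are quotients of binary forms by the determinant \<open>D\<close> of
  \<open>(h, g)\<close>. If \<open>P\<close> is in the saturation, then \<open>D\<close> divides the numerators, because a finite zero
  scheme leaves the coefficients of \<open>h\<close> and \<open>g\<close> without a common factor. So \<open>\<alpha>\<close> is linear
  and \<open>\<beta>\<close> is constant, hence \<open>P\<close> is a combination of $x_{2,0} h, x_{2,1} h, g$.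
\<close>

section \<open>Evaluation of polynomials\<close>

text \<open>
  The orders on the variables serve only to make the polynomial rings integral domains: this is known
  for monoids of monomials that carry a compatible linear order.
\<close>

instantiation xvar :: linorder
begin
definition less_eq_xvar :: "xvar \<Rightarrow> xvar \<Rightarrow> bool" where
  "x \<le> y \<longleftrightarrow> case_xvar 0 1 2 (3::nat) x \<le> case_xvar 0 1 2 3 y"
definition less_xvar :: "xvar \<Rightarrow> xvar \<Rightarrow> bool" where
  "x < y \<longleftrightarrow> case_xvar 0 1 2 (3::nat) x < case_xvar 0 1 2 3 y"
instance
  by standard (auto simp: less_eq_xvar_def less_xvar_def split: xvar.splits)
end

instantiation zvar :: linorder
begin
definition less_eq_zvar :: "zvar \<Rightarrow> zvar \<Rightarrow> bool" where
  "x \<le> y \<longleftrightarrow> case_zvar 0 1 (2::nat) x \<le> case_zvar 0 1 2 y"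
definition less_zvar :: "zvar \<Rightarrow> zvar \<Rightarrow> bool" where
  "x < y \<longleftrightarrow> case_zvar 0 1 (2::nat) x < case_zvar 0 1 2 y"
instance
  by standard (auto simp: less_eq_zvar_def less_zvar_def split: zvar.splits)
end

text \<open>
  Ring homomorphisms. They describe the scalars along which polynomials are evaluated, and also arbitrary
  changes of rings such as evaluation itself.
\<close>

definition coeff_hom :: "('k::comm_ring_1 \<Rightarrow> 'r::comm_ring_1) \<Rightarrow> bool" where
  "coeff_hom \<kappa> \<longleftrightarrow> \<kappa> 0 = 0 \<and> \<kappa> 1 = 1 \<and> (\<forall>a b. \<kappa> (a + b) = \<kappa> a + \<kappa> b) \<and> (\<forall>a b. \<kappa> (a * b) = \<kappa> a * \<kappa> b)"

lemma coeff_homD: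
  assumes "coeff_hom \<kappa>"
  shows "\<kappa> 0 = 0" "\<kappa> 1 = 1" "\<kappa> (a + b) = \<kappa> a + \<kappa> b" "\<kappa> (a * b) = \<kappa> a * \<kappa> b"
    "\<kappa> (- a) = - \<kappa> a" "\<kappa> (a - b) = \<kappa> a - \<kappa> b" "\<kappa> (sum g A) = (\<Sum>i\<in>A. \<kappa> (g i))"
proof -
  show 0: "\<kappa> 0 = 0" and "\<kappa> 1 = 1" and add: "\<kappa> (a + b) = \<kappa> a + \<kappa> b"
    and "\<kappa> (a * b) = \<kappa> a * \<kappa> b" for a b
    using assms by (auto simp: coeff_hom_def)
  show neg: "\<kappa> (- a) = - \<kappa> a" for a
    using add[of a "- a"] 0 by (simp add: add_eq_0_iff)
  show "\<kappa> (a - b) = \<kappa> a - \<kappa> b"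
    using add[of a "- b"] neg[of b] by simp
  show "\<kappa> (sum g A) = (\<Sum>i\<in>A. \<kappa> (g i))"
    by (induction A rule: infinite_finite_induct) (auto simp: 0 add)
qed

lemma coeff_hom_Const: "coeff_hom Const"
  by (auto simp: coeff_hom_def Const_def single_add mult_single)

lemma coeff_hom_pCons: "coeff_hom \<kappa> \<Longrightarrow> coeff_hom (\<lambda>c. [:\<kappa> c:])"
  by (auto simp: coeff_hom_def one_pCons)

lemma coeff_hom_id: "coeff_hom (\<lambda>c. c)"
  by (auto simp: coeff_hom_def)

text \<open>
  The homomorphism that acts as \<open>\<kappa>\<close> on the coefficients and sends the variable \<open>v\<close> to \<open>s v\<close>.
  In contrast to \<open>subst\<close>, the target is any commutative ring; the charts of the product of projective
  lines and the generic points used below are all evaluations of this kind.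
\<close>

definition ev :: "('k::comm_ring_1 \<Rightarrow> 'r::comm_ring_1) \<Rightarrow> ('v \<Rightarrow> 'r) \<Rightarrow> ('v, 'k) mpoly \<Rightarrow> 'r" where
  "ev \<kappa> s p = (\<Sum>m\<in>Poly_Mapping.keys p. \<kappa> (Poly_Mapping.lookup p m) *
      (\<Prod>v\<in>Poly_Mapping.keys m. s v ^ Poly_Mapping.lookup m v))"

lemma subst_eq_ev: "subst \<sigma> = ev Const \<sigma>"
  by (simp add: fun_eq_iff subst_def ev_def)

abbreviation evm :: "('v \<Rightarrow> 'r::comm_ring_1) \<Rightarrow> ('v \<Rightarrow>\<^sub>0 nat) \<Rightarrow> 'r" where
  "evm s m \<equiv> (\<Prod>v\<in>Poly_Mapping.keys m. s v ^ Poly_Mapping.lookup m v)"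

lemma evm_superset:
  assumes "finite A" "Poly_Mapping.keys m \<subseteq> A"
  shows "evm s m = (\<Prod>v\<in>A. s v ^ Poly_Mapping.lookup m v)"
  using assms by (intro prod.mono_neutral_left) (auto simp: in_keys_iff)

lemma evm_add: "evm s (m + n) = evm s m * evm s n"
proof -
  let ?A = "Poly_Mapping.keys m \<union> Poly_Mapping.keys n"
  have "evm s (m + n) = (\<Prod>v\<in>?A. s v ^ Poly_Mapping.lookup (m + n) v)"
    by (rule evm_superset) (auto simp: in_keys_iff lookup_add)
  also have "\<dots> = (\<Prod>v\<in>?A. s v ^ Poly_Mapping.lookup m v) * (\<Prod>v\<in>?A. s v ^ Poly_Mapping.lookup n v)"
    by (simp add: lookup_add power_add prod.distrib)
  also have "\<dots> = evm s m * evm s n"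
    by (simp add: evm_superset[of ?A m s] evm_superset[of ?A n s])
  finally show ?thesis .
qed

context
  fixes \<kappa> :: "'k::comm_ring_1 \<Rightarrow> 'r::comm_ring_1"
  assumes \<kappa>: "coeff_hom \<kappa>"
begin

lemma ev_superset:
  assumes "finite A" "Poly_Mapping.keys p \<subseteq> A"
  shows "ev \<kappa> s p = (\<Sum>m\<in>A. \<kappa> (Poly_Mapping.lookup p m) * evm s m)"
  unfolding ev_def using assms
  by (intro sum.mono_neutral_left) (auto simp: in_keys_iff coeff_homD[OF \<kappa>])

lemma ev_single: "ev \<kappa> s (Poly_Mapping.single m c) = \<kappa> c * evm s m"
  by (subst ev_superset[of "{m}"]) auto

lemma ev_0: "ev \<kappa> s 0 = 0"
  by (simp add: ev_def)

lemma ev_add: "ev \<kappa> s (p + q) = ev \<kappa> s p + ev \<kappa> s q"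
proof -
  let ?A = "Poly_Mapping.keys p \<union> Poly_Mapping.keys q"
  have "ev \<kappa> s (p + q) = (\<Sum>m\<in>?A. \<kappa> (Poly_Mapping.lookup (p + q) m) * evm s m)"
    by (rule ev_superset) (auto simp: keys_add)
  then show ?thesis
    by (simp add: lookup_add coeff_homD[OF \<kappa>] distrib_right sum.distrib ev_superset[of ?A])
qed

lemma ev_sum: "ev \<kappa> s (sum g A) = (\<Sum>i\<in>A. ev \<kappa> s (g i))"
  by (induction A rule: infinite_finite_induct) (auto simp: ev_0 ev_add)

end

lemma mpoly_eq_sum_single:
  "p = (\<Sum>m\<in>Poly_Mapping.keys p. Poly_Mapping.single m (Poly_Mapping.lookup p m))"
  by (rule poly_mapping_eqI) (simp add: lookup_sum lookup_single when_def in_keys_iff)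

lemma mpoly_induct [case_names single add]:
  fixes p :: "('v, 'k::comm_ring_1) mpoly"
  assumes "\<And>m c. P (Poly_Mapping.single m c)" "\<And>p q. P p \<Longrightarrow> P q \<Longrightarrow> P (p + q)"
  shows "P p"
proof -
  have "P (\<Sum>m\<in>A. Poly_Mapping.single m (Poly_Mapping.lookup p m))" if "finite A" for A
    using that assms(1)[of 0 0] by induction (auto intro: assms)
  then show ?thesis
    by (subst mpoly_eq_sum_single) simp
qed

context
  fixes \<kappa> :: "'k::comm_ring_1 \<Rightarrow> 'r::comm_ring_1"
  assumes \<kappa>: "coeff_hom \<kappa>"
begin

lemma ev_mult: "ev \<kappa> s (p * q) = ev \<kappa> s p * ev \<kappa> s q"
proof (induction p rule: mpoly_induct)
  case (single m c)
  show ?case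
    by (induction q rule: mpoly_induct)
      (simp_all add: mult_single ev_single[OF \<kappa>] ev_add[OF \<kappa>] evm_add coeff_homD[OF \<kappa>] algebra_simps)
qed (simp add: ev_add[OF \<kappa>] algebra_simps)

lemma ev_Const: "ev \<kappa> s (Const c) = \<kappa> c"
  by (simp add: Const_def ev_single[OF \<kappa>])

lemma ev_Var: "ev \<kappa> s (Var v) = s v"
  by (simp add: Var_def ev_single[OF \<kappa>] coeff_homD[OF \<kappa>])

lemma ev_1: "ev \<kappa> s 1 = 1"
  using ev_Const[of s 1] by (simp add: Const_def coeff_homD[OF \<kappa>])

lemma ev_uminus: "ev \<kappa> s (- p) = - ev \<kappa> s p"
  using ev_add[OF \<kappa>, of s p "- p"] by (simp add: ev_0[OF \<kappa>] add_eq_0_iff)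

lemma ev_diff: "ev \<kappa> s (p - q) = ev \<kappa> s p - ev \<kappa> s q"
  using ev_add[OF \<kappa>, of s p "- q"] by (simp add: ev_uminus)

lemma ev_power: "ev \<kappa> s (p ^ n) = ev \<kappa> s p ^ n"
  by (induction n) (auto simp: ev_1 ev_mult)

lemma ev_prod: "ev \<kappa> s (prod g A) = (\<Prod>i\<in>A. ev \<kappa> s (g i))"
  by (induction A rule: infinite_finite_induct) (auto simp: ev_1 ev_mult)

lemmas ev_simps = ev_0[OF \<kappa>] ev_1 ev_add[OF \<kappa>] ev_mult ev_Const ev_Var ev_uminus ev_diff ev_power
  ev_sum[OF \<kappa>] ev_prod

lemma ev_subst: "ev \<kappa> s (subst \<sigma> p) = ev \<kappa> (\<lambda>v. ev \<kappa> s (\<sigma> v)) p"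
  unfolding subst_def ev_def[of \<kappa> "\<lambda>v. ev \<kappa> s (\<sigma> v)"] by (simp only: ev_simps)

text \<open>
  Modulo \<open>d\<close> the value of a polynomial depends only on its arguments modulo \<open>d\<close>.
\<close>

lemma ev_diff_dvd:
  assumes "\<And>v. d dvd s v - s' v"
  shows "d dvd ev \<kappa> s p - ev \<kappa> s' p"
proof -
  have mult: "d dvd x * y - x' * y'" if "d dvd x - x'" "d dvd y - y'" for x y x' y' :: 'r
  proof -
    have "x * y - x' * y' = (x - x') * y + x' * (y - y')" by (simp add: algebra_simps)
    then show ?thesis using that by (simp add: dvd_add)
  qed
  have power: "d dvd x ^ n - x' ^ n" if "d dvd x - x'" for x x' :: 'r and n
    by (induction n) (auto intro: mult that)
  have monom: "d dvd (\<Prod>v\<in>A. s v ^ e v) - (\<Prod>v\<in>A. s' v ^ e v)" for A and e :: "_ \<Rightarrow> nat"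
    by (induction A rule: infinite_finite_induct) (auto intro!: mult power assms)
  show ?thesis
    unfolding ev_def sum_subtractf[symmetric] right_diff_distrib[symmetric]
    by (intro dvd_sum dvd_mult monom)
qed

end

lemma subst_Var: "subst Var p = p"
proof (induction p rule: mpoly_induct)
  case (single m c)
  have pow: "Var v ^ n = Poly_Mapping.single (Poly_Mapping.single v n) (1::'b)" for v :: 'a and n
    by (induction n) (auto simp: Var_def mult_single single_add[symmetric] single_one)
  have "(\<Prod>v\<in>A. Poly_Mapping.single (g v) (1::'b)) = Poly_Mapping.single (\<Sum>v\<in>A. g v) 1"
    if "finite A" for A and g :: "'a \<Rightarrow> 'a \<Rightarrow>\<^sub>0 nat"
    using that by induction (auto simp: mult_single single_one)
  then have "evm Var m = Poly_Mapping.single m (1::'b)"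
    using mpoly_eq_sum_single[of m, symmetric] by (simp add: pow)
  then show ?case
    by (simp add: subst_eq_ev ev_single[OF coeff_hom_Const] Const_def mult_single)
qed (simp add: subst_eq_ev ev_add[OF coeff_hom_Const])

lemma coeff_hom_ev: "coeff_hom \<kappa> \<Longrightarrow> coeff_hom (ev \<kappa> s)"
  by (simp add: coeff_hom_def[of "ev \<kappa> s"] ev_simps)

lemma coeff_hom_power: "coeff_hom \<phi> \<Longrightarrow> \<phi> (x ^ n) = \<phi> x ^ n"
  by (induction n) (auto simp: coeff_homD)

lemma coeff_hom_const_poly: "coeff_hom (\<lambda>c::'a::comm_ring_1. [:c:])"
  by (rule coeff_hom_pCons[OF coeff_hom_id])

lemma coeff_hom_prod: "coeff_hom \<phi> \<Longrightarrow> \<phi> (prod g A) = (\<Prod>i\<in>A. \<phi> (g i))"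
  by (induction A rule: infinite_finite_induct) (auto simp: coeff_homD)

lemma ev_hom:
  assumes "coeff_hom \<phi>"
  shows "\<phi> (ev \<kappa> s p) = ev (\<lambda>c. \<phi> (\<kappa> c)) (\<lambda>v. \<phi> (s v)) p"
  by (simp add: ev_def coeff_homD[OF assms] coeff_hom_power[OF assms] coeff_hom_prod[OF assms])

section \<open>Binary forms and forms of bi-degree (1, n)\<close>

text \<open>
  The binary form of degree \<open>n\<close> whose dehomogenisation is \<open>p\<close>, evaluated at \<open>(s, t)\<close>. It
  represents \<open>p\<close> faithfully if \<open>degree p \<le> n\<close>; larger coefficients of \<open>p\<close> are ignored.
\<close>

definition bform :: "('k::field \<Rightarrow> 'r::comm_ring_1) \<Rightarrow> nat \<Rightarrow> 'k poly \<Rightarrow> 'r \<Rightarrow> 'r \<Rightarrow> 'r" where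
  "bform \<kappa> n p s t = (\<Sum>k\<le>n. \<kappa> (coeff p k) * s ^ k * t ^ (n - k))"

lemma bform_hom:
  assumes "coeff_hom \<phi>"
  shows "\<phi> (bform \<kappa> n p s t) = bform (\<lambda>c. \<phi> (\<kappa> c)) n p (\<phi> s) (\<phi> t)"
  by (simp add: bform_def coeff_homD[OF assms] coeff_hom_power[OF assms])

context
  fixes \<kappa> :: "'k::field \<Rightarrow> 'r::comm_ring_1"
  assumes \<kappa>: "coeff_hom \<kappa>"
begin

lemma bform_0: "bform \<kappa> n 0 s t = 0"
  by (simp add: bform_def coeff_homD[OF \<kappa>])

lemma bform_add: "bform \<kappa> n (p + q) s t = bform \<kappa> n p s t + bform \<kappa> n q s t"
  by (simp add: bform_def coeff_homD[OF \<kappa>] sum.distrib algebra_simps)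

lemma bform_diff: "bform \<kappa> n (p - q) s t = bform \<kappa> n p s t - bform \<kappa> n q s t"
  by (simp add: bform_def coeff_homD[OF \<kappa>] sum_subtractf algebra_simps)

lemma bform_smult: "bform \<kappa> n (smult c p) s t = \<kappa> c * bform \<kappa> n p s t"
  by (simp add: bform_def coeff_homD[OF \<kappa>] sum_distrib_left algebra_simps)

lemma bform_sum: "bform \<kappa> n (sum g A) s t = (\<Sum>i\<in>A. bform \<kappa> n (g i) s t)"
  by (induction A rule: infinite_finite_induct) (auto simp: bform_0 bform_add)

lemma bform_monom:
  assumes "k \<le> n"
  shows "bform \<kappa> n (monom c k) s t = \<kappa> c * s ^ k * t ^ (n - k)"
proof -
  have "bform \<kappa> n (monom c k) s t = (\<Sum>i\<le>n. if i = k then \<kappa> c * s ^ i * t ^ (n - i) else 0)"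
    unfolding bform_def by (intro sum.cong) (auto simp: coeff_homD[OF \<kappa>])
  then show ?thesis using assms by simp
qed

lemma bform_mult:
  assumes "degree p \<le> n" "degree q \<le> m"
  shows "bform \<kappa> (n + m) (p * q) s t = bform \<kappa> n p s t * bform \<kappa> m q s t"
proof -
  have "p * q = (\<Sum>i\<le>n. monom (coeff p i) i) * (\<Sum>j\<le>m. monom (coeff q j) j)"
    using assms by (simp add: poly_as_sum_of_monoms')
  also have "\<dots> = (\<Sum>i\<le>n. \<Sum>j\<le>m. monom (coeff p i * coeff q j) (i + j))"
    by (simp add: sum_product mult_monom)
  finally have "bform \<kappa> (n + m) (p * q) s t
      = (\<Sum>i\<le>n. \<Sum>j\<le>m. bform \<kappa> (n + m) (monom (coeff p i * coeff q j) (i + j)) s t)"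
    by (simp add: bform_sum)
  also have "\<dots> = (\<Sum>i\<le>n. \<Sum>j\<le>m. (\<kappa> (coeff p i) * s ^ i * t ^ (n - i)) *
      (\<kappa> (coeff q j) * s ^ j * t ^ (m - j)))"
  proof (intro sum.cong refl)
    fix i j assume "i \<in> {..n}" "j \<in> {..m}"
    then have le: "i + j \<le> n + m" and e: "t ^ (n + m - (i + j)) = t ^ (n - i) * t ^ (m - j)"
      by (auto simp: power_add[symmetric] intro!: arg_cong[where f = "(^) t"])
    show "bform \<kappa> (n + m) (monom (coeff p i * coeff q j) (i + j)) s t =
        \<kappa> (coeff p i) * s ^ i * t ^ (n - i) * (\<kappa> (coeff q j) * s ^ j * t ^ (m - j))"
      unfolding bform_monom[OF le] e power_add coeff_homD[OF \<kappa>] by (simp add: mult_ac)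
  qed
  finally show ?thesis by (simp add: bform_def sum_product)
qed

lemma bform_linear: "bform \<kappa> 1 [:a, b:] s t = \<kappa> a * t + \<kappa> b * s"
  by (simp add: bform_def)

lemma bform_X_mult:
  assumes "degree p \<le> n"
  shows "bform \<kappa> (Suc n) ([:0, 1:] * p) s t = s * bform \<kappa> n p s t"
  using bform_mult[of "[:0, 1:]" 1 p n s t] assms by (simp only: bform_linear) (simp add: coeff_homD[OF \<kappa>])

lemma bform_Suc:
  assumes "degree p \<le> n"
  shows "bform \<kappa> (Suc n) p s t = t * bform \<kappa> n p s t"
  using bform_mult[of "[:1, 0:]" 1 p n s t] assms by (simp only: bform_linear) (simp add: coeff_homD[OF \<kappa>])

lemma bform_scale: "bform \<kappa> n p (c * s) (c * t) = c ^ n * bform \<kappa> n p s t"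
proof -
  have "c ^ n = c ^ k * c ^ (n - k)" if "k \<le> n" for k
    using that by (simp add: power_add[symmetric])
  then show ?thesis
    unfolding bform_def sum_distrib_left by (intro sum.cong) (simp_all add: power_mult_distrib algebra_simps)
qed

lemma map_poly_coeff_hom: "coeff_hom (map_poly \<kappa>)"
  unfolding coeff_hom_def
proof (intro conjI allI)
  show "map_poly \<kappa> 0 = 0" by simp
  show "map_poly \<kappa> 1 = 1" by (simp add: coeff_homD[OF \<kappa>] map_poly_1')
  show "map_poly \<kappa> (p + q) = map_poly \<kappa> p + map_poly \<kappa> q" for p q
    by (intro poly_eqI) (simp add: coeff_map_poly coeff_homD[OF \<kappa>])
  show "map_poly \<kappa> (p * q) = map_poly \<kappa> p * map_poly \<kappa> q" for p q
    by (intro poly_eqI) (simp add: coeff_map_poly coeff_homD[OF \<kappa>] coeff_mult)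
qed

lemma bform_affine_map:
  assumes "degree p \<le> n"
  shows "bform (\<lambda>c. [:\<kappa> c:]) n p [:0, 1:] 1 = map_poly \<kappa> p"
proof -
  have "map_poly \<kappa> p = (\<Sum>k\<le>n. monom (\<kappa> (coeff p k)) k)"
    using poly_as_sum_of_monoms'[of "map_poly \<kappa> p" n] assms map_poly_degree_leq[of \<kappa> p]
    by (simp add: coeff_map_poly coeff_homD[OF \<kappa>])
  then show ?thesis
    by (simp add: bform_def monom_altdef)
qed

end

lemma degree_power_bound:
  assumes "degree p \<le> n"
  shows "degree (p ^ k) \<le> k * n"
  by (subst mult.commute) (rule order.trans[OF degree_power_le mult_le_mono1[OF assms]])

lemma bform_1:
  assumes "coeff_hom \<kappa>"
  shows "bform \<kappa> 0 1 s t = 1"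
  by (simp add: bform_def coeff_homD[OF assms])

lemma bform_power:
  assumes \<kappa>: "coeff_hom \<kappa>" and p: "degree p \<le> n"
  shows "bform \<kappa> (k * n) (p ^ k) s t = bform \<kappa> n p s t ^ k"
proof (induction k)
  case (Suc k)
  have "degree (p ^ k) \<le> k * n" by (rule degree_power_bound[OF p])
  then show ?case using bform_mult[OF \<kappa> p, of "p ^ k" "k * n" s t] Suc by simp
qed (simp add: bform_1[OF \<kappa>])

lemma bform_affine: "degree p \<le> n \<Longrightarrow> bform (\<lambda>c. [:c:]) n p [:0, 1:] 1 = p"
  using bform_affine_map[OF coeff_hom_id, of p n] by (simp add: map_poly_id')

text \<open>
  In the chart at infinity the coefficients of a form appear in reverse order.
\<close>

lemma coeff_bform_at_infinity:
  assumes "j \<le> n"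
  shows "coeff (bform (\<lambda>c. [:c:]) n p 1 [:0, 1:]) j = coeff p (n - j)"
proof -
  have "bform (\<lambda>c. [:c:]) n p 1 [:0, 1:] = (\<Sum>k\<le>n. monom (coeff p k) (n - k))"
    by (simp add: bform_def monom_altdef)
  then have "coeff (bform (\<lambda>c. [:c:]) n p 1 [:0, 1:]) j
      = (\<Sum>k\<le>n. if n - k = j then coeff p k else 0)"
    by (simp add: coeff_sum)
  also have "\<dots> = (\<Sum>k\<le>n. if k = n - j then coeff p k else 0)"
    using assms by (intro sum.cong) auto
  finally have "coeff (bform (\<lambda>c. [:c:]) n p 1 [:0, 1:]) j
      = (\<Sum>k\<le>n. if k = n - j then coeff p k else 0)" .
  then show ?thesis by simp
qed

text \<open>
  The form of bi-degree $(1, n)$ with coefficients \<open>p\<close> and \<open>q\<close> at the first pair of variables,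
  evaluated at \<open>s\<close>.
\<close>

definition form :: "('k::field \<Rightarrow> 'r::comm_ring_1) \<Rightarrow> nat \<Rightarrow> 'k poly \<Rightarrow> 'k poly \<Rightarrow> (xvar \<Rightarrow> 'r) \<Rightarrow> 'r" where
  "form \<kappa> n p q s = s X10 * bform \<kappa> n p (s X20) (s X21) + s X11 * bform \<kappa> n q (s X20) (s X21)"

abbreviation xform :: "nat \<Rightarrow> 'k::field poly \<Rightarrow> 'k poly \<Rightarrow> (xvar, 'k) mpoly" where
  "xform n p q \<equiv> form Const n p q Var"

lemma ev_bform:
  assumes "coeff_hom \<kappa>"
  shows "ev \<kappa> s (bform Const n p u v) = bform \<kappa> n p (ev \<kappa> s u) (ev \<kappa> s v)"
  using bform_hom[OF coeff_hom_ev[OF assms], of s Const n p u v] by (simp add: ev_Const[OF assms])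

lemma ev_form:
  assumes "coeff_hom \<kappa>"
  shows "ev \<kappa> s (xform n p q) = form \<kappa> n p q s"
  by (simp add: form_def ev_simps[OF assms] ev_bform[OF assms])

lemma form_add:
  assumes "coeff_hom \<kappa>"
  shows "form \<kappa> n p q s + form \<kappa> n p' q' s = form \<kappa> n (p + p') (q + q') s"
  by (simp add: form_def bform_add[OF assms] algebra_simps)

lemma form_sum:
  assumes "coeff_hom \<kappa>"
  shows "(\<Sum>i\<in>A. \<kappa> (c i) * form \<kappa> n (p i) (q i) s)
    = form \<kappa> n (\<Sum>i\<in>A. smult (c i) (p i)) (\<Sum>i\<in>A. smult (c i) (q i)) s"
  by (simp add: form_def bform_sum[OF assms] bform_smult[OF assms] sum.distrib sum_distrib_left algebra_simps)

lemma form_mult: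
  assumes "coeff_hom \<kappa>" "degree r \<le> m" "degree p \<le> n" "degree q \<le> n"
  shows "bform \<kappa> m r (s X20) (s X21) * form \<kappa> n p q s = form \<kappa> (m + n) (r * p) (r * q) s"
  using assms by (simp add: form_def bform_mult[OF assms(1)] distrib_left mult.left_commute)

lemma form_sum_forms:
  assumes "coeff_hom \<kappa>"
  shows "(\<Sum>i\<in>A. form \<kappa> n (p i) (q i) s) = form \<kappa> n (\<Sum>i\<in>A. p i) (\<Sum>i\<in>A. q i) s"
  by (simp add: form_def bform_sum[OF assms] sum.distrib sum_distrib_left)

lemma form_X_mult:
  assumes "coeff_hom \<kappa>" "degree p \<le> n" "degree q \<le> n"
  shows "s X20 * form \<kappa> n p q s = form \<kappa> (Suc n) ([:0, 1:] * p) ([:0, 1:] * q) s"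
  by (simp only: form_def bform_X_mult[OF assms(1,2)] bform_X_mult[OF assms(1,3)]) (simp add: algebra_simps)

lemma form_Suc:
  assumes "coeff_hom \<kappa>" "degree p \<le> n" "degree q \<le> n"
  shows "s X21 * form \<kappa> n p q s = form \<kappa> (Suc n) p q s"
  by (simp only: form_def bform_Suc[OF assms(1,2)] bform_Suc[OF assms(1,3)]) (simp add: algebra_simps)

lemma form_power_mult:
  assumes "coeff_hom \<kappa>" "degree p \<le> n" "degree q \<le> n"
  shows "s X21 ^ m * form \<kappa> n p q s = form \<kappa> (m + n) p q s"
  using form_mult[OF assms(1) _ assms(2,3), of 1 m s] bform_monom[OF assms(1), of 0 m 1 "s X20" "s X21"]
  by (simp add: monom_0 one_pCons coeff_homD[OF assms(1)])

lemma xform_inject: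
  assumes "degree p \<le> n" "degree q \<le> n" "degree p' \<le> n" "degree q' \<le> n"
    and eq: "xform n p q = xform n p' q'"
  shows "p = p'" "q = q'"
proof -
  note \<kappa> = coeff_hom_const_poly
  have *: "form (\<lambda>c. [:c:]) n p q s = form (\<lambda>c. [:c:]) n p' q' s" for s
    using eq ev_form[OF \<kappa>, of s n] by metis
  show "p = p'" using *[of "case_xvar 1 0 [:0, 1:] 1"] assms by (simp add: form_def bform_affine)
  show "q = q'" using *[of "case_xvar 0 1 [:0, 1:] 1"] assms by (simp add: form_def bform_affine)
qed

section \<open>Homogeneity\<close>

text \<open>
  Both gradings of the polynomial rings, the bi-degree and the total degree, are of this kind.
\<close>

definition additive_grading :: "(('v \<Rightarrow>\<^sub>0 nat) \<Rightarrow> 'g::comm_monoid_add) \<Rightarrow> bool" where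
  "additive_grading deg \<longleftrightarrow> deg 0 = 0 \<and> (\<forall>m n. deg (m + n) = deg m + deg n)"

lemma additive_bideg: "additive_grading bideg"
  by (auto simp: additive_grading_def bideg_def lookup_add zero_prod_def)

lemma additive_tdeg: "additive_grading tdeg"
  by (auto simp: additive_grading_def tdeg_def lookup_add)

lemma homog_0: "homog deg d 0"
  by (simp add: homog_def)

lemma homog_add: "homog deg d p \<Longrightarrow> homog deg d q \<Longrightarrow> homog deg d (p + q)"
  using keys_add[of p q] by (auto simp: homog_def)

lemma homog_uminus: "homog deg d (p :: ('v, 'k::comm_ring_1) mpoly) \<Longrightarrow> homog deg d (- p)"
  by (auto simp: homog_def in_keys_iff)

lemma homog_diff: "homog deg d p \<Longrightarrow> homog deg d q \<Longrightarrow> homog deg d (p - q :: ('v, 'k::comm_ring_1) mpoly)"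
  using homog_add[of deg d p "- q"] by (simp add: homog_uminus)

lemma homog_sum: "(\<And>i. i \<in> A \<Longrightarrow> homog deg d (g i)) \<Longrightarrow> homog deg d (sum g A)"
  by (induction A rule: infinite_finite_induct) (auto simp: homog_0 homog_add)

lemma homog_single: "deg m = d \<Longrightarrow> homog deg d (Poly_Mapping.single m c)"
  by (auto simp: homog_def split: if_splits)

lemma homog_mult:
  assumes "additive_grading deg" "homog deg d p" "homog deg e q"
  shows "homog deg (d + e) (p * q)"
  using keys_mult[of p q] assms by (fastforce simp: homog_def additive_grading_def)

lemma homog_Const: "additive_grading deg \<Longrightarrow> homog deg 0 (Const c)"
  by (simp add: Const_def homog_single additive_grading_def)

lemma homog_1: "additive_grading deg \<Longrightarrow> homog deg 0 (1 :: ('v, 'k::comm_ring_1) mpoly)"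
  using homog_Const[of deg 1] by (simp add: coeff_homD[OF coeff_hom_Const])

lemma homog_power:
  fixes p :: "(zvar, 'k::comm_ring_1) mpoly"
  assumes "homog tdeg d p"
  shows "homog tdeg (n * d) (p ^ n)"
  using assms by (induction n) (auto simp: homog_1 additive_tdeg intro!: homog_mult)

lemma homog_bform:
  assumes "homog tdeg 1 u" "homog tdeg 1 v"
  shows "homog tdeg n (bform Const n p u v)"
  unfolding bform_def
proof (rule homog_sum)
  fix k assume "k \<in> {..n}"
  moreover have "homog tdeg (0 + k * 1 + (n - k) * 1) (Const (coeff p k) * u ^ k * v ^ (n - k))"
    by (intro homog_mult homog_power homog_Const additive_tdeg assms)
  ultimately show "homog tdeg n (Const (coeff p k) * u ^ k * v ^ (n - k))" by simp
qed

lemma evm_xvar: "evm s m = s X10 ^ Poly_Mapping.lookup m X10 * s X11 ^ Poly_Mapping.lookup m X11 *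
    s X20 ^ Poly_Mapping.lookup m X20 * s X21 ^ Poly_Mapping.lookup m X21"
  by (subst evm_superset[of "{X10, X11, X20, X21}"]) (auto intro: xvar.exhaust simp: algebra_simps)

lemma evm_zvar: "evm s m = s Z0 ^ Poly_Mapping.lookup m Z0 * s Z1 ^ Poly_Mapping.lookup m Z1 *
    s Z2 ^ Poly_Mapping.lookup m Z2"
  by (subst evm_superset[of "{Z0, Z1, Z2}"]) (auto intro: zvar.exhaust simp: algebra_simps)

lemma single_eq_monomial: "Poly_Mapping.single m c = Const c * evm Var m"
  using subst_Var[of "Poly_Mapping.single m c"]
  by (simp add: subst_eq_ev ev_single[OF coeff_hom_Const])

lemma xform_of_homog:
  fixes p :: "(xvar, 'k::field) mpoly"
  assumes "homog bideg (1, n) p"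
  obtains a b where "degree a \<le> n" "degree b \<le> n" "p = xform n a b"
proof -
  let ?F = "\<lambda>q. \<exists>a b. degree a \<le> n \<and> degree b \<le> n \<and> q = xform n a b"
  have sum: "?F (sum g A)" if "\<And>i. i \<in> A \<Longrightarrow> ?F (g i)" for g and A :: "(xvar \<Rightarrow>\<^sub>0 nat) set"
    using that
  proof (induction A rule: infinite_finite_induct)
    case (insert i A)
    then obtain a b a' b' where
      *: "degree a \<le> n" "degree b \<le> n" "degree a' \<le> n" "degree b' \<le> n" "sum g A = xform n a b"
      "g i = xform n a' b'"
      by (metis insertCI)
    show ?case
      using insert(1,2) * form_add[OF coeff_hom_Const, of n a' b' Var a b]
      by (intro exI[of _ "a' + a"] exI[of _ "b' + b"]) (auto intro: degree_add_le)
  qed (auto intro!: exI[of _ 0] simp: form_def bform_0[OF coeff_hom_Const])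
  have single: "?F (Poly_Mapping.single m c)" if "bideg m = (1, n)" for m c
  proof -
    let ?k = "Poly_Mapping.lookup m X20"
    have k: "?k \<le> n" "Poly_Mapping.lookup m X21 = n - ?k"
      using that by (auto simp: bideg_def)
    from that consider "Poly_Mapping.lookup m X10 = 1 \<and> Poly_Mapping.lookup m X11 = 0"
      | "Poly_Mapping.lookup m X10 = 0 \<and> Poly_Mapping.lookup m X11 = 1"
      by (fastforce simp: bideg_def)
    then show ?thesis
    proof cases
      case 1
      then have "Poly_Mapping.single m c = xform n (monom c ?k) 0"
        using k by (simp add: single_eq_monomial evm_xvar form_def bform_monom bform_0 coeff_hom_Const)
      with k show ?thesis by (intro exI conjI) (auto intro: order.trans[OF degree_monom_le])
    next
      case 2
      then have "Poly_Mapping.single m c = xform n 0 (monom c ?k)"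
        using k by (simp add: single_eq_monomial evm_xvar form_def bform_monom bform_0 coeff_hom_Const)
      with k show ?thesis by (intro exI conjI) (auto intro: order.trans[OF degree_monom_le])
    qed
  qed
  have "?F (\<Sum>m\<in>Poly_Mapping.keys p. Poly_Mapping.single m (Poly_Mapping.lookup p m))"
    by (intro sum single) (use assms in \<open>simp add: homog_def\<close>)
  then have "?F p" by (simp only: mpoly_eq_sum_single[symmetric])
  then show ?thesis using that by blast
qed

lemma homog_Var_bideg: "homog bideg (1, 0) (Var X10)" "homog bideg (1, 0) (Var X11)"
  "homog bideg (0, 1) (Var X20)" "homog bideg (0, 1) (Var X21)"
  by (auto simp: Var_def bideg_def lookup_single intro!: homog_single)

lemma homog_Var_tdeg: "homog tdeg 1 (Var v)"
  by (cases v) (auto simp: Var_def tdeg_def lookup_single intro!: homog_single)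

lemma homog_bideg_power:
  fixes p :: "(xvar, 'k::comm_ring_1) mpoly"
  assumes "homog bideg (d, e) p"
  shows "homog bideg (n * d, n * e) (p ^ n)"
proof (induction n)
  case 0
  show ?case using homog_1[OF additive_bideg] by (simp add: zero_prod_def)
next
  case (Suc n)
  then show ?case using homog_mult[OF additive_bideg assms Suc] by simp
qed

lemma homog_xform: "homog bideg (1, n) (xform n a b)"
proof -
  have bform: "homog bideg (0, n) (bform Const n p (Var X20) (Var X21))" for p :: "'a poly"
    unfolding bform_def
  proof (rule homog_sum)
    fix k assume "k \<in> {..n}"
    moreover have "homog bideg (0 + (k * 0, k * 1) + ((n - k) * 0, (n - k) * 1))
        (Const (coeff p k) * Var X20 ^ k * Var X21 ^ (n - k))"
      by (intro homog_mult homog_bideg_power homog_Const additive_bideg homog_Var_bideg)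
    ultimately show "homog bideg (0, n) (Const (coeff p k) * Var X20 ^ k * Var X21 ^ (n - k))"
      by (simp add: zero_prod_def)
  qed
  show ?thesis
    unfolding form_def
    using homog_mult[OF additive_bideg homog_Var_bideg(1) bform[of a]]
      homog_mult[OF additive_bideg homog_Var_bideg(2) bform[of b]]
    by (intro homog_add) simp_all
qed

lemma ev_homog_scale:
  assumes "coeff_hom \<kappa>" "homog tdeg n p"
  shows "ev \<kappa> (\<lambda>v. c * s v) p = c ^ n * ev \<kappa> s p"
proof -
  have "evm (\<lambda>v. c * s v) m = c ^ n * evm s m" if "m \<in> Poly_Mapping.keys p" for m
    using that assms(2) unfolding evm_zvar homog_def tdeg_def
    by (auto simp: power_mult_distrib power_add mult_ac)
  then show ?thesis
    by (simp add: ev_def sum_distrib_left algebra_simps)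
qed

section \<open>Ideals\<close>

lemma UNIV_zvar: "UNIV = {Z0, Z1, Z2}"
  using zvar.exhaust by auto

lemma sum_zvar: "(\<Sum>i\<in>UNIV. g i) = g Z0 + g Z1 + g Z2"
  by (simp add: UNIV_zvar add_ac)

lemma module_times: "module ((*) :: 'r::comm_ring_1 \<Rightarrow> 'r \<Rightarrow> 'r)"
  by standard (simp_all add: algebra_simps)

lemmas ideal_base = module.span_base[OF module_times]
  and ideal_minimal = module.span_minimal[OF module_times]
  and is_ideal_gen = module.subspace_span[OF module_times]
  and is_ideal_def = module.subspace_def[OF module_times]

lemma idealD:
  assumes "is_ideal J"
  shows "0 \<in> J" "x \<in> J \<Longrightarrow> y \<in> J \<Longrightarrow> x + y \<in> J" "x \<in> J \<Longrightarrow> c * x \<in> J"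
    "(\<And>i. i \<in> A \<Longrightarrow> g i \<in> J) \<Longrightarrow> sum g A \<in> J"
proof -
  show 0: "0 \<in> J" and add: "x \<in> J \<Longrightarrow> y \<in> J \<Longrightarrow> x + y \<in> J" and "x \<in> J \<Longrightarrow> c * x \<in> J" for x y c
    using assms by (auto simp: is_ideal_def)
  show "(\<And>i. i \<in> A \<Longrightarrow> g i \<in> J) \<Longrightarrow> sum g A \<in> J"
    by (induction A rule: infinite_finite_induct) (auto simp: 0 add)
qed

lemma is_ideal_multiples: "is_ideal {x. d dvd x}"
  by (auto simp: is_ideal_def)

lemma is_ideal_vimage:
  assumes "coeff_hom \<phi>" "is_ideal J"
  shows "is_ideal {x. \<phi> x \<in> J}"
  using assms(2) by (auto simp: is_ideal_def coeff_homD[OF assms(1)])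

lemma is_ideal_base_ideal: "is_ideal (base_ideal f)"
  by (simp add: base_ideal_def is_ideal_gen)

lemma base_ideal_gens: "f i \<in> base_ideal f"
  unfolding base_ideal_def by (rule ideal_base) (cases i; simp)

lemma base_ideal_iff: "p \<in> base_ideal f \<longleftrightarrow> (\<exists>r. p = (\<Sum>i\<in>UNIV. r i * f i))"
proof
  let ?T = "{p. \<exists>r. p = (\<Sum>i\<in>UNIV. r i * f i)}"
  have "is_ideal ?T"
    unfolding is_ideal_def
  proof (intro conjI ballI allI)
    show "0 \<in> ?T" by (auto intro!: exI[of _ "\<lambda>_. 0"])
    fix x y c assume "x \<in> ?T" "y \<in> ?T"
    then obtain r s where "x = (\<Sum>i\<in>UNIV. r i * f i)" "y = (\<Sum>i\<in>UNIV. s i * f i)" by auto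
    then show "x + y \<in> ?T"
      by (auto intro!: exI[of _ "\<lambda>i. r i + s i"] simp: distrib_right sum.distrib)
  next
    fix x c assume "x \<in> ?T"
    then obtain r where "x = (\<Sum>i\<in>UNIV. r i * f i)" by auto
    then show "c * x \<in> ?T"
      by (auto intro!: exI[of _ "\<lambda>i. c * r i"] simp: sum_distrib_left mult.assoc)
  qed
  moreover have "f i \<in> ?T" for i
    by (cases i; intro CollectI exI[of _ "\<lambda>j. if j = i then 1 else 0"]) (simp_all add: sum_zvar)
  ultimately have "base_ideal f \<subseteq> ?T"
    unfolding base_ideal_def by (intro ideal_minimal) auto
  then show "p \<in> base_ideal f \<Longrightarrow> \<exists>r. p = (\<Sum>i\<in>UNIV. r i * f i)" by auto
next
  assume "\<exists>r. p = (\<Sum>i\<in>UNIV. r i * f i)"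
  then show "p \<in> base_ideal f"
    using is_ideal_base_ideal[of f] base_ideal_gens[of f] by (auto intro!: idealD)
qed

lemma bideg_eq_0D:
  assumes "bideg m = (0, 0)"
  shows "m = 0"
proof (rule poly_mapping_eqI)
  fix v show "Poly_Mapping.lookup m v = Poly_Mapping.lookup 0 v"
    using assms by (cases v) (auto simp: bideg_def)
qed

text \<open>
  Multiplication by a polynomial without constant term strictly raises the bi-degree.
\<close>

lemma lookup_mult_no_constant_term:
  fixes p q :: "(xvar, 'k::comm_ring_1) mpoly"
  assumes "homog bideg d q" "\<forall>m\<in>Poly_Mapping.keys p. m \<noteq> 0" "bideg m = d"
  shows "Poly_Mapping.lookup (p * q) m = 0"
proof (rule ccontr)
  assume "Poly_Mapping.lookup (p * q) m \<noteq> 0"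
  then obtain k l where kl: "m = k + l" "k \<in> Poly_Mapping.keys p" "l \<in> Poly_Mapping.keys q"
    using keys_mult[of p q] by (auto simp: in_keys_iff)
  then have "bideg k + d = d"
    using assms(1,3) additive_bideg by (auto simp: homog_def additive_grading_def)
  then have "bideg k = (0, 0)" by (cases d; cases "bideg k") auto
  then show False using kl assms(2) bideg_eq_0D by auto
qed

text \<open>
  In the degree of its generators an ideal is just their linear span: the nonconstant parts of the
  coefficients contribute to other degrees only.
\<close>

lemma homog_in_base_ideal:
  fixes f :: "zvar \<Rightarrow> (xvar, 'k::comm_ring_1) mpoly"
  assumes f: "\<And>i. homog bideg d (f i)" and p: "p \<in> base_ideal f" "homog bideg d p"
  obtains c where "p = (\<Sum>i\<in>UNIV. Const (c i) * f i)"
proof -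
  obtain r where r: "p = (\<Sum>i\<in>UNIV. r i * f i)" using p(1) by (auto simp: base_ideal_iff)
  define c where "c i = Poly_Mapping.lookup (r i) 0" for i
  let ?e = "p - (\<Sum>i\<in>UNIV. Const (c i) * f i)"
  have e: "?e = (\<Sum>i\<in>UNIV. (r i - Const (c i)) * f i)"
    by (simp add: r left_diff_distrib sum_subtractf)
  have "homog bideg (0 + d) (Const (c i) * f i)" for i
    by (intro homog_mult homog_Const additive_bideg f)
  then have "homog bideg d (\<Sum>i\<in>UNIV. Const (c i) * f i)"
    by (intro homog_sum) simp
  then have homog: "homog bideg d ?e" by (rule homog_diff[OF p(2)])
  have "Poly_Mapping.lookup (r i - Const (c i)) 0 = 0" for i
    by (simp add: lookup_minus Const_def c_def)
  then have nonconst: "\<forall>m\<in>Poly_Mapping.keys (r i - Const (c i)). m \<noteq> 0" for i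
    by (metis lookup_eq_zero_in_keys_contradict)
  have vanish: "Poly_Mapping.lookup ?e m = 0" if m: "bideg m = d" for m
    unfolding e lookup_sum
  proof (rule sum.neutral, rule ballI)
    fix i show "Poly_Mapping.lookup ((r i - Const (c i)) * f i) m = 0"
      by (rule lookup_mult_no_constant_term[OF f nonconst m])
  qed
  have "Poly_Mapping.lookup ?e m = 0" for m
  proof (cases "bideg m = d")
    case False
    then have "m \<notin> Poly_Mapping.keys ?e" using homog by (auto simp only: homog_def)
    then show ?thesis by (simp only: not_in_keys_iff_lookup_eq_zero)
  qed (rule vanish)
  then have "?e = 0" by (intro poly_mapping_eqI) (simp only: lookup_zero)
  then have "p = (\<Sum>i\<in>UNIV. Const (c i) * f i)" by (simp only: right_minus_eq)
  then show ?thesis by (rule that)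
qed

section \<open>Dominance\<close>

definition homog_part :: "(('v \<Rightarrow>\<^sub>0 nat) \<Rightarrow> 'g) \<Rightarrow> 'g \<Rightarrow> ('v, 'k::comm_ring_1) mpoly \<Rightarrow> ('v, 'k) mpoly" where
  "homog_part deg g p = (\<Sum>m\<in>{m \<in> Poly_Mapping.keys p. deg m = g}. Poly_Mapping.single m (Poly_Mapping.lookup p m))"

lemma lookup_homog_part: "Poly_Mapping.lookup (homog_part deg g p) m = (if deg m = g then Poly_Mapping.lookup p m else 0)"
  by (auto simp: homog_part_def lookup_sum lookup_single when_def in_keys_iff)

lemma homog_part_add: "homog_part deg g (p + q) = homog_part deg g p + homog_part deg g q"
  by (rule poly_mapping_eqI) (simp add: lookup_homog_part lookup_add)

lemma homog_part_0: "homog_part deg g 0 = 0"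
  by (simp add: homog_part_def)

lemma homog_part_sum: "homog_part deg g (sum h A) = (\<Sum>i\<in>A. homog_part deg g (h i))"
  by (induction A rule: infinite_finite_induct) (auto simp: homog_part_0 homog_part_add)

lemma homog_homog_part: "homog deg g (homog_part deg g p)"
  by (auto simp: homog_def in_keys_iff lookup_homog_part split: if_splits)

lemma homog_part_of_homog: "homog deg e p \<Longrightarrow> homog_part deg g p = (if e = g then p else 0)"
  by (rule poly_mapping_eqI) (auto simp: lookup_homog_part homog_def in_keys_iff)

lemma sum_homog_part: "(\<Sum>g\<in>deg ` Poly_Mapping.keys p. homog_part deg g p) = p"
  by (rule poly_mapping_eqI) (auto simp: lookup_sum lookup_homog_part in_keys_iff)

text \<open>
  The elements all of whose homogeneous parts lie in \<open>J\<close> form an ideal, because a product with a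
  monomial only shifts the parts; this ideal contains the homogeneous generators of \<open>J\<close>.
\<close>

lemma homog_part_in_homog_ideal:
  assumes deg: "additive_grading deg" and J: "homog_ideal deg J" and "p \<in> J"
  shows "homog_part deg g p \<in> J"
proof -
  have ideal: "is_ideal J" and gen: "J = ideal_gen {p \<in> J. \<exists>d. homog deg d p}"
    using J by (auto simp: homog_ideal_def)
  let ?T = "{p \<in> J. \<forall>g. homog_part deg g p \<in> J}"
  have "is_ideal ?T"
    unfolding is_ideal_def
  proof (intro conjI ballI allI)
    show "0 \<in> ?T" by (simp add: homog_part_0 idealD(1)[OF ideal])
    show "x + y \<in> ?T" if "x \<in> ?T" "y \<in> ?T" for x y
      using that by (auto simp: homog_part_add intro: idealD(2)[OF ideal])
    show "r * x \<in> ?T" if x: "x \<in> ?T" for r x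
    proof (induction r rule: mpoly_induct)
      case (single m c)
      let ?s = "Poly_Mapping.single m c"
      have "homog_part deg g (?s * x) \<in> J" for g
      proof -
        have "homog_part deg g (?s * x) = (\<Sum>e\<in>deg ` Poly_Mapping.keys x. homog_part deg g (?s * homog_part deg e x))"
          by (simp only: homog_part_sum[symmetric] sum_distrib_left[symmetric] sum_homog_part)
        moreover have "homog_part deg g (?s * homog_part deg e x) \<in> J" for e
        proof -
          have "homog deg (deg m + e) (?s * homog_part deg e x)"
            by (intro homog_mult deg homog_single homog_homog_part refl)
          moreover have "?s * homog_part deg e x \<in> J"
            using x by (auto intro: idealD(3)[OF ideal])
          ultimately show ?thesis by (simp add: homog_part_of_homog idealD(1)[OF ideal])
        qed
        ultimately show ?thesis by (simp add: idealD(4)[OF ideal])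
      qed
      then show ?case using x by (auto intro: idealD(3)[OF ideal])
    next
      case (add r s)
      then show ?case by (auto simp: distrib_right homog_part_add intro: idealD(2)[OF ideal])
    qed
  qed
  moreover have "{p \<in> J. \<exists>d. homog deg d p} \<subseteq> ?T"
    by (auto simp: homog_part_of_homog idealD(1)[OF ideal])
  ultimately have "J \<subseteq> ?T"
    by (subst gen) (rule ideal_minimal)
  with \<open>p \<in> J\<close> show ?thesis by auto
qed

lemma homog_idealI:
  assumes ideal: "is_ideal J" and comp: "\<And>p g. p \<in> J \<Longrightarrow> homog_part deg g p \<in> J"
  shows "homog_ideal deg J"
proof -
  let ?H = "{p \<in> J. \<exists>d. homog deg d p}"
  have "p \<in> ideal_gen ?H" if "p \<in> J" for p
  proof -
    have "homog_part deg g p \<in> ideal_gen ?H" for g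
      using comp[OF that] by (intro ideal_base CollectI conjI exI[of _ g] homog_homog_part)
    then have "(\<Sum>g\<in>deg ` Poly_Mapping.keys p. homog_part deg g p) \<in> ideal_gen ?H"
      by (intro idealD(4)[OF is_ideal_gen])
    then show ?thesis by (simp only: sum_homog_part)
  qed
  then have "J \<subseteq> ideal_gen ?H" by (rule subsetI)
  moreover have "ideal_gen ?H \<subseteq> J"
    using ideal by (intro ideal_minimal) auto
  ultimately show ?thesis
    unfolding homog_ideal_def using ideal by (intro conjI equalityI)
qed

lemma homog_subst:
  assumes f: "\<And>i. homog bideg (1, d) (f i)" and h: "homog tdeg n h"
  shows "homog bideg (n, n * d) (subst f h)"
  unfolding subst_def
proof (rule homog_sum)
  fix m assume "m \<in> Poly_Mapping.keys h"
  then have n: "n = Poly_Mapping.lookup m Z0 + Poly_Mapping.lookup m Z1 + Poly_Mapping.lookup m Z2"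
    using h by (auto simp: homog_def tdeg_def)
  have pow: "homog bideg (k, k * d) (f i ^ k)" for i k
    using homog_bideg_power[OF f[of i], of k] by simp
  note mult = homog_mult[OF additive_bideg]
  note homog = mult[OF homog_Const[OF additive_bideg] mult[OF mult[OF pow pow] pow]]
  show "homog bideg (n, n * d) (Const (Poly_Mapping.lookup h m) * evm f m)"
    using homog unfolding evm_zvar n by (simp add: add_mult_distrib)
qed

text \<open>
  As all \<open>f i\<close> have the same bi-degree $(1, d)$, the substitution multiplies degrees by $(1, d)$;
  distinct degrees stay distinct, so it respects homogeneous parts.
\<close>

lemma homog_part_subst:
  assumes f: "\<And>i. homog bideg (1, d) (f i)"
  shows "homog_part bideg (n, n * d) (subst f h) = subst f (homog_part tdeg n h)"
proof -
  have "homog_part bideg (n, n * d) (subst f h)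
      = (\<Sum>k\<in>tdeg ` Poly_Mapping.keys h. homog_part bideg (n, n * d) (subst f (homog_part tdeg k h)))"
    by (simp only: homog_part_sum[symmetric] subst_eq_ev ev_sum[OF coeff_hom_Const, symmetric] sum_homog_part)
  also have "\<dots> = (\<Sum>k\<in>tdeg ` Poly_Mapping.keys h. if k = n then subst f (homog_part tdeg n h) else 0)"
    by (intro sum.cong refl) (auto simp: homog_part_of_homog[OF homog_subst[OF f homog_homog_part]])
  also have "\<dots> = subst f (homog_part tdeg n h)"
  proof (cases "n \<in> tdeg ` Poly_Mapping.keys h")
    case False
    then have "homog_part tdeg n h = 0"
      by (intro poly_mapping_eqI) (auto simp: lookup_homog_part in_keys_iff)
    then show ?thesis using False by (simp add: subst_eq_ev ev_0[OF coeff_hom_Const])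
  qed simp
  finally show ?thesis .
qed

lemma map_point_in_P2:
  fixes f :: "zvar \<Rightarrow> (xvar, 'k::comm_ring_1) mpoly"
  assumes f: "\<And>i. homog bideg (1, d) (f i)" and P: "P \<in> P1xP1 - V_x (base_ideal f)"
  shows "map_point f P \<in> P2"
proof -
  have prime: "prime_ideal P" and ideal: "is_ideal P" and hom: "homog_ideal bideg P"
    and nsub: "\<not> base_ideal f \<subseteq> P"
    using P by (auto simp: P1xP1_def V_x_def prime_ideal_def)
  note \<phi> = coeff_hom_ev[OF coeff_hom_Const, of f]
  have M: "map_point f P = {h. ev Const f h \<in> P}" by (simp add: map_point_def subst_eq_ev)
  have idealM: "is_ideal (map_point f P)"
    unfolding M by (rule is_ideal_vimage[OF \<phi> ideal])
  have "1 \<notin> P"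
    using prime idealD(3)[OF ideal, of 1] by (auto simp: prime_ideal_def)
  then have "1 \<notin> map_point f P"
    by (simp add: M ev_simps[OF coeff_hom_Const])
  then have "map_point f P \<noteq> UNIV" by blast
  then have "prime_ideal (map_point f P)"
    using idealM prime by (auto simp: prime_ideal_def M ev_simps[OF coeff_hom_Const])
  moreover have "homog_ideal tdeg (map_point f P)"
  proof (rule homog_idealI)
    fix h n assume "h \<in> map_point f P"
    then have "homog_part bideg (n, n * d) (subst f h) \<in> P"
      by (intro homog_part_in_homog_ideal[OF additive_bideg hom]) (simp add: map_point_def)
    then show "homog_part tdeg n h \<in> map_point f P"
      by (simp add: map_point_def homog_part_subst[OF f])
  qed (rule idealM)
  moreover have "\<not> irrelevant_z \<subseteq> map_point f P"
  proof
    assume *: "irrelevant_z \<subseteq> map_point f P"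
    have "f i \<in> P" for i
    proof -
      have "Var i \<in> irrelevant_z" unfolding irrelevant_z_def by (rule ideal_base) simp
      with * show ?thesis by (auto simp: M ev_simps[OF coeff_hom_Const])
    qed
    then have "base_ideal f \<subseteq> P"
      unfolding base_ideal_def by (intro ideal_minimal ideal) auto
    with nsub show False by simp
  qed
  ultimately show ?thesis by (simp add: P2_def)
qed

lemma Var_neq_0: "Var v \<noteq> (0 :: ('v, 'k::comm_ring_1) mpoly)"
proof
  assume "Var v = (0 :: ('v, 'k) mpoly)"
  then have "Poly_Mapping.lookup (Var v :: ('v, 'k) mpoly) (Poly_Mapping.single v 1) = 0"
    by (simp only: lookup_zero)
  then show False by (simp add: Var_def)
qed

lemma zero_ideal_in_P2: "{0 :: (zvar, 'k::idom) mpoly} \<in> P2"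
proof -
  have "is_ideal {0 :: (zvar, 'k) mpoly}" by (auto simp: is_ideal_def)
  moreover have "(Var Z0 :: (zvar, 'k) mpoly) \<noteq> 0" by (rule Var_neq_0)
  moreover have "(Var Z0 :: (zvar, 'k) mpoly) \<in> irrelevant_z"
    unfolding irrelevant_z_def by (rule ideal_base) simp
  ultimately show ?thesis
    by (auto simp: P2_def prime_ideal_def homog_part_0 intro!: homog_idealI)
qed

text \<open>
  A form \<open>h\<close> that is killed by the substitution vanishes on the image, hence everywhere by dominance, in
  particular at the generic point, which is the zero ideal. So \<open>h = 0\<close>. The homogeneous parts of a
  general element of the kernel are again in the kernel.
\<close>

lemma subst_injective_of_dominant:
  fixes f :: "zvar \<Rightarrow> (xvar, 'k::field) mpoly"
  assumes f: "\<And>i. homog bideg (1, d) (f i)" and dom: "dominant f" and h: "subst f h = 0"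
  shows "h = 0"
proof -
  have "homog_part tdeg n h = 0" for n
  proof -
    let ?h = "homog_part tdeg n h"
    have "subst f ?h = 0"
      using homog_part_subst[where f = f and d = d and n = n and h = h] f by (simp add: h homog_part_0)
    have "map_point f P \<in> V_z {?h}" if P: "P \<in> P1xP1 - V_x (base_ideal f)" for P
    proof -
      have "0 \<in> P" using P by (intro idealD(1)) (simp add: P1xP1_def prime_ideal_def)
      then show ?thesis
        using map_point_in_P2[OF f P] \<open>subst f ?h = 0\<close> by (simp add: V_z_def map_point_def)
    qed
    then have "map_point f ` (P1xP1 - V_x (base_ideal f)) \<subseteq> V_z {?h}" by blast
    then have "V_z {?h} = P2" using dom unfolding dominant_def by blast
    then have "{0} \<in> V_z {?h}" by (simp only: zero_ideal_in_P2)
    then show ?thesis by (simp add: V_z_def)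
  qed
  then have "(\<Sum>n\<in>tdeg ` Poly_Mapping.keys h. homog_part tdeg n h) = 0" by simp
  then show ?thesis by (simp add: sum_homog_part)
qed

section \<open>Linear algebra and divisibility over the base field and its polynomial ring\<close>

lemma smult_dependent:
  fixes e :: "'i \<Rightarrow> 'k::field poly"
  assumes fin: "finite I" and deg: "\<And>i. i \<in> I \<Longrightarrow> degree (e i) \<le> M" and card: "card I > Suc M"
  obtains c where "\<exists>i\<in>I. c i \<noteq> 0" "(\<Sum>i\<in>I. smult (c i) (e i)) = 0"
proof -
  interpret vs: vector_space "smult :: 'k \<Rightarrow> 'k poly \<Rightarrow> 'k poly"
    by unfold_locales (simp_all add: smult_add_right smult_add_left)
  show thesis
  proof (cases "inj_on e I")
    case True
    have "e i \<in> vs.span (monom 1 ` {..M})" if "i \<in> I" for i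
    proof -
      have "e i = (\<Sum>k\<le>M. smult (coeff (e i) k) (monom 1 k))"
        using poly_as_sum_of_monoms'[OF deg[OF that]] by (simp add: smult_monom)
      also have "\<dots> \<in> vs.span (monom 1 ` {..M})"
        by (intro vs.span_sum vs.span_scale vs.span_base) auto
      finally show ?thesis .
    qed
    then have span: "e ` I \<subseteq> vs.span (monom 1 ` {..M})" by blast
    have "card (monom (1::'k) ` {..M}) \<le> Suc M"
      using card_image_le[of "{..M}" "monom (1::'k)"] by simp
    moreover have "card (e ` I) = card I" using True by (rule card_image)
    moreover have "card (e ` I) \<le> card (monom (1::'k) ` {..M})" if "vs.independent (e ` I)"
      using vs.independent_span_bound[OF _ that span] by simp
    ultimately have "vs.dependent (e ` I)" using card by linarith
    then obtain u where "\<exists>v\<in>e ` I. u v \<noteq> 0" "(\<Sum>v\<in>e ` I. smult (u v) v) = 0"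
      using iffD1[OF vs.dependent_finite[OF finite_imageI[OF fin]]] by blast
    then show thesis
      using True by (intro that[of "\<lambda>i. u (e i)"]) (simp_all add: sum.reindex)
  next
    case False
    then obtain i j where ij: "i \<in> I" "j \<in> I" "i \<noteq> j" "e i = e j"
      by (auto simp: inj_on_def)
    let ?c = "\<lambda>k. if k = i then 1 else if k = j then - 1 else 0"
    have "(\<Sum>k\<in>I. smult (?c k) (e k))
        = (\<Sum>k\<in>I. (if k = i then e i else 0) + (if k = j then - e j else 0))"
      using ij(3) by (intro sum.cong) auto
    also have "\<dots> = e i - e j"
      using ij(1,2) fin by (simp add: sum.distrib)
    also have "\<dots> = 0" using ij(4) by simp
    finally show thesis
      using ij(1) by (intro that[of ?c]) auto
  qed
qed

text \<open>
  The ring of polynomials in one variable over a field is a principal ideal domain: an element of least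
  degree in the ideal generated by the \<open>p i\<close> divides all of them, and is a combination of them.
\<close>

lemma common_factor:
  fixes p :: "zvar \<Rightarrow> 'k::field poly"
  assumes "\<exists>i. p i \<noteq> 0"
  obtains c q r where "c \<noteq> 0" "\<And>i. p i = c * q i" "(\<Sum>i\<in>UNIV. r i * q i) = 1"
proof -
  define J where "J = {x. x \<noteq> 0 \<and> (\<exists>s. x = (\<Sum>i\<in>UNIV. s i * p i))}"
  have gen: "p i = (\<Sum>j\<in>UNIV. (if j = i then 1 else 0) * p j)" for i
    by (cases i) (simp_all add: sum_zvar)
  from assms obtain i where "p i \<noteq> 0" by blast
  then have "p i \<in> J"
    unfolding J_def using gen[of i] by (intro CollectI conjI exI[of _ "\<lambda>j. if j = i then 1 else 0"])
  then have "\<exists>c. c \<in> J \<and> (\<forall>x. x \<in> J \<longrightarrow> degree c \<le> degree x)"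
    by (rule ex_has_least_nat)
  then obtain c where c: "c \<in> J" "\<And>x. x \<in> J \<Longrightarrow> degree c \<le> degree x" by blast
  then obtain s where s: "c \<noteq> 0" "c = (\<Sum>i\<in>UNIV. s i * p i)" by (auto simp: J_def)
  have "c dvd p i" for i
  proof (rule ccontr)
    assume "\<not> c dvd p i"
    then have nz: "p i mod c \<noteq> 0" by (simp add: mod_eq_0_iff_dvd)
    have "p i mod c = p i - (p i div c) * c" by (simp add: minus_div_mult_eq_mod)
    also have "\<dots> = (\<Sum>j\<in>UNIV. (if j = i then 1 else 0) * p j) - (p i div c) * (\<Sum>j\<in>UNIV. s j * p j)"
      by (simp only: gen[of i, symmetric] s(2)[symmetric])
    also have "\<dots> = (\<Sum>j\<in>UNIV. ((if j = i then 1 else 0) - (p i div c) * s j) * p j)"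
      by (simp only: sum_distrib_left sum_subtractf left_diff_distrib mult.assoc)
    finally have "p i mod c \<in> J"
      using nz unfolding J_def
      by (intro CollectI conjI exI[of _ "\<lambda>j. (if j = i then 1 else 0) - (p i div c) * s j"])
    then have "degree c \<le> degree (p i mod c)" by (rule c(2))
    moreover have "degree (p i mod c) < degree c" using s(1) nz by (rule degree_mod_less')
    ultimately show False by simp
  qed
  then have "\<exists>q. p i = c * q" for i by (auto simp: dvd_def)
  then obtain q where q: "\<And>i. p i = c * q i" by metis
  have "c * (\<Sum>i\<in>UNIV. s i * q i) = c"
    by (subst (2) s(2)) (simp add: q sum_distrib_left mult_ac)
  then have "(\<Sum>i\<in>UNIV. s i * q i) = 1" using s(1) by simp
  with s(1) q show thesis by (rule that)
qed

lemma prime_divisor_field_poly: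
  fixes c :: "'k::field poly"
  assumes "degree c > 0"
  obtains \<pi> where "prime_elem \<pi>" "\<pi> dvd c"
proof -
  have "c dvd c \<and> degree c > 0" using assms by simp
  then have "\<exists>\<pi>. (\<pi> dvd c \<and> degree \<pi> > 0) \<and> (\<forall>x. x dvd c \<and> degree x > 0 \<longrightarrow> degree \<pi> \<le> degree x)"
    by (rule ex_has_least_nat)
  then obtain \<pi> where \<pi>: "\<pi> dvd c" "degree \<pi> > 0" "\<And>x. x dvd c \<Longrightarrow> degree x > 0 \<Longrightarrow> degree \<pi> \<le> degree x"
    by blast
  have "irreducible \<pi>"
  proof (rule irreducibleI)
    show "\<pi> \<noteq> 0" using \<pi>(2) by auto
    then show "\<not> \<pi> dvd 1" using \<pi>(2) by (simp add: is_unit_iff_degree)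
    fix x y assume xy: "\<pi> = x * y"
    then have nz: "x \<noteq> 0" "y \<noteq> 0" using \<open>\<pi> \<noteq> 0\<close> by auto
    then have "degree \<pi> = degree x + degree y" by (simp add: xy degree_mult_eq)
    moreover have "x dvd c" "y dvd c" using \<pi>(1) xy by (auto intro: dvd_trans)
    ultimately have "degree x = 0 \<or> degree y = 0" using \<pi>(3)[of x] by fastforce
    then show "x dvd 1 \<or> y dvd 1" using nz by (simp add: is_unit_iff_degree)
  qed
  then show thesis using that \<pi>(1) field_poly_irreducible_imp_prime by blast
qed

text \<open>
  A form of Gauss's lemma. A prime \<open>\<pi>\<close> of the coefficient ring stays prime as a constant polynomial, so
  it divides \<open>W\<close> as soon as it divides both products, and it can be cancelled from both divisibilities.
  Doing so for the prime factors of \<open>c\<close> one after the other proves the claim.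
\<close>

lemma const_dvd_cancel_powers:
  fixes U V W :: "'k::field poly poly"
  assumes "c \<noteq> 0" and coprime: "\<And>\<pi>. prime_elem \<pi> \<Longrightarrow> \<not> ([:\<pi>:] dvd U \<and> [:\<pi>:] dvd V)"
    and "[:c:] dvd U ^ n * W" "[:c:] dvd V ^ n * W"
  shows "[:c:] dvd W"
  using assms(1,3,4)
proof (induction "degree c" arbitrary: c W rule: less_induct)
  case less
  show ?case
  proof (cases "degree c > 0")
    case False
    then show ?thesis using less.prems(1) by (simp add: is_unit_iff_degree is_unit_const_poly_iff unit_imp_dvd)
  next
    case True
    then obtain \<pi> where \<pi>: "prime_elem \<pi>" "\<pi> dvd c" by (rule prime_divisor_field_poly)
    then obtain c' where c': "c = \<pi> * c'" by (auto simp: dvd_def)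
    have prime: "prime_elem [:\<pi>:]" using \<pi>(1) by (rule lift_prime_elem_poly)
    have c'_dvd: "[:c:] = [:\<pi>:] * [:c':]" by (simp add: c')
    have "[:\<pi>:] dvd U ^ n * W" "[:\<pi>:] dvd V ^ n * W"
      by (rule dvd_mult_left, rule less.prems(2,3)[unfolded c'_dvd])+
    then have "[:\<pi>:] dvd W"
      using coprime[OF \<pi>(1)] prime by (metis prime_elem_dvd_mult_iff prime_elem_dvd_power)
    then obtain W' where W': "W = [:\<pi>:] * W'" by (auto simp: dvd_def)
    have nz: "c' \<noteq> 0" "\<pi> \<noteq> 0" using less.prems(1) by (auto simp: c')
    have "degree \<pi> > 0" using \<pi>(1) nz by (metis prime_elem_not_unit is_unit_iff_degree gr0I)
    then have "degree c' < degree c" using nz by (simp add: c' degree_mult_eq)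
    moreover have "[:\<pi>:] \<noteq> 0" using nz by simp
    moreover have "[:\<pi>:] * [:c':] dvd [:\<pi>:] * (U ^ n * W')" "[:\<pi>:] * [:c':] dvd [:\<pi>:] * (V ^ n * W')"
      using less.prems(2,3) unfolding c'_dvd W' by (simp_all only: mult.left_commute)
    ultimately have "[:c':] dvd W'"
      using less.hyps[OF _ nz(1)] by (simp only: dvd_mult_cancel_left) blast
    then show ?thesis unfolding c'_dvd W' by (rule mult_dvd_mono[OF dvd_refl])
  qed
qed

text \<open>
  The cross product of \<open>A\<close> and \<open>B\<close> is normal to the plane that they span. A vector \<open>w\<close> of this plane
  is a combination of \<open>A\<close> and \<open>B\<close> once it is multiplied by any entry of the cross product; the
  coefficients come from Cramer's rule.
\<close>

lemma plane_spanned: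
  fixes A B w :: "zvar \<Rightarrow> 'r::idom"
  assumes E: "(A Z1 * B Z2 - A Z2 * B Z1) * w Z0 + (A Z2 * B Z0 - A Z0 * B Z2) * w Z1
    + (A Z0 * B Z1 - A Z1 * B Z0) * w Z2 = 0"
  shows "(A Z1 * B Z2 - A Z2 * B Z1) * w l
      = (w Z1 * B Z2 - w Z2 * B Z1) * A l + (A Z1 * w Z2 - A Z2 * w Z1) * B l"
    and "(A Z2 * B Z0 - A Z0 * B Z2) * w l
      = (w Z2 * B Z0 - w Z0 * B Z2) * A l + (A Z2 * w Z0 - A Z0 * w Z2) * B l"
    and "(A Z0 * B Z1 - A Z1 * B Z0) * w l
      = (w Z0 * B Z1 - w Z1 * B Z0) * A l + (A Z0 * w Z1 - A Z1 * w Z0) * B l"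
proof -
  let ?E = "(A Z1 * B Z2 - A Z2 * B Z1) * w Z0 + (A Z2 * B Z0 - A Z0 * B Z2) * w Z1
    + (A Z0 * B Z1 - A Z1 * B Z0) * w Z2"
  have "(A Z1 * B Z2 - A Z2 * B Z1) * w l - ((w Z1 * B Z2 - w Z2 * B Z1) * A l + (A Z1 * w Z2 - A Z2 * w Z1) * B l)
      = (if l = Z0 then ?E else 0)"
    by (cases l) (simp_all add: algebra_simps)
  then show "(A Z1 * B Z2 - A Z2 * B Z1) * w l = (w Z1 * B Z2 - w Z2 * B Z1) * A l + (A Z1 * w Z2 - A Z2 * w Z1) * B l"
    unfolding E by (simp only: if_cancel right_minus_eq)
  have "(A Z2 * B Z0 - A Z0 * B Z2) * w l - ((w Z2 * B Z0 - w Z0 * B Z2) * A l + (A Z2 * w Z0 - A Z0 * w Z2) * B l)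
      = (if l = Z1 then ?E else 0)"
    by (cases l) (simp_all add: algebra_simps)
  then show "(A Z2 * B Z0 - A Z0 * B Z2) * w l = (w Z2 * B Z0 - w Z0 * B Z2) * A l + (A Z2 * w Z0 - A Z0 * w Z2) * B l"
    unfolding E by (simp only: if_cancel right_minus_eq)
  have "(A Z0 * B Z1 - A Z1 * B Z0) * w l - ((w Z0 * B Z1 - w Z1 * B Z0) * A l + (A Z0 * w Z1 - A Z1 * w Z0) * B l)
      = (if l = Z2 then ?E else 0)"
    by (cases l) (simp_all add: algebra_simps)
  then show "(A Z0 * B Z1 - A Z1 * B Z0) * w l = (w Z0 * B Z1 - w Z1 * B Z0) * A l + (A Z0 * w Z1 - A Z1 * w Z0) * B l"
    unfolding E by (simp only: if_cancel right_minus_eq)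
qed

text \<open>
  The divisibility at infinity compares the orders of vanishing there: a form of degree \<open>n\<close> with
  dehomogenisation \<open>D\<close> vanishes at infinity to the order \<open>n - degree D\<close>.
\<close>

lemma degree_quotient_at_infinity:
  fixes D N Q :: "'k::field poly"
  assumes D: "D \<noteq> 0" "degree D \<le> n" and N: "N = D * Q" "degree N \<le> n + m"
    and dvd: "bform (\<lambda>c. [:c:]) n D 1 [:0, 1:] dvd bform (\<lambda>c. [:c:]) (n + m) N 1 [:0, 1:]"
  shows "degree Q \<le> m"
proof (cases "Q = 0")
  case False
  define k where "k = n - degree D"
  have "monom 1 k dvd bform (\<lambda>c. [:c:]) n D 1 [:0, 1:]"
    unfolding monom_1_dvd_iff'
    by (auto simp: coeff_bform_at_infinity k_def intro!: coeff_eq_0)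
  then have "monom 1 k dvd bform (\<lambda>c. [:c:]) (n + m) N 1 [:0, 1:]" using dvd by (rule dvd_trans)
  then have "coeff (bform (\<lambda>c. [:c:]) (n + m) N 1 [:0, 1:]) j = 0" if "j < k" for j
    using that unfolding monom_1_dvd_iff' by blast
  then have zero: "coeff N (n + m - j) = 0" if "j < k" for j
    using that coeff_bform_at_infinity[of j "n + m" N] by (simp add: k_def)
  have "N \<noteq> 0" using False D N by simp
  have "degree N \<le> degree D + m"
  proof (rule ccontr)
    assume "\<not> ?thesis"
    then have "n + m - degree N < k" using N(2) D(2) by (simp add: k_def)
    from zero[OF this] have "coeff N (degree N) = 0" using N(2) by simp
    then show False using \<open>N \<noteq> 0\<close> by simp
  qed
  then show ?thesis using False D by (simp add: N(1) degree_mult_eq)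
qed simp

section \<open>The irrelevant ideal, saturation, and finite zero schemes\<close>

lemma is_ideal_two_gens:
  fixes s t :: "'r::comm_ring_1"
  shows "is_ideal {p. \<exists>c e. p = c * s + e * t}"
  unfolding is_ideal_def
proof (intro conjI ballI allI)
  let ?T = "{p. \<exists>c e. p = c * s + e * t}"
  show "0 \<in> ?T" by (intro CollectI exI[of _ 0]) simp
  fix x assume "x \<in> ?T"
  then obtain c e where x: "x = c * s + e * t" by blast
  show "r * x \<in> ?T" for r
    unfolding x by (intro CollectI exI[of _ "r * c"] exI[of _ "r * e"]) (simp add: algebra_simps)
  fix y assume "y \<in> ?T"
  then obtain c' e' where y: "y = c' * s + e' * t" by blast
  show "x + y \<in> ?T"
    unfolding x y by (intro CollectI exI[of _ "c + c'"] exI[of _ "e + e'"]) (simp add: algebra_simps)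
qed

lemma irrelevant_x_member:
  fixes p :: "(xvar, 'k::comm_ring_1) mpoly"
  assumes "p \<in> irrelevant_x"
  shows "\<exists>c e. p = c * Var X20 + e * Var X21"
proof -
  let ?T = "{p :: (xvar, 'k) mpoly. \<exists>c e. p = c * Var X20 + e * Var X21}"
  have "is_ideal ?T"
    by (rule is_ideal_two_gens)
  moreover have "Poly_Mapping.single m c \<in> ?T" if "0 < snd (bideg m)" for m and c :: 'k
  proof -
    let ?rest = "Const c * (Var X10 ^ Poly_Mapping.lookup m X10 * Var X11 ^ Poly_Mapping.lookup m X11)"
    have eq: "Poly_Mapping.single m c
        = ?rest * (Var X20 ^ Poly_Mapping.lookup m X20 * Var X21 ^ Poly_Mapping.lookup m X21)"
      by (simp add: single_eq_monomial evm_xvar mult.assoc)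
    from that have "0 < Poly_Mapping.lookup m X20 \<or> 0 < Poly_Mapping.lookup m X21"
      by (auto simp: bideg_def)
    then consider j where "Poly_Mapping.lookup m X20 = Suc j" | j where "Poly_Mapping.lookup m X21 = Suc j"
      using gr0_implies_Suc by metis
    then show ?thesis
    proof cases
      case 1
      then show ?thesis unfolding eq
        by (intro CollectI exI[of _ "?rest * (Var X20 ^ j * Var X21 ^ Poly_Mapping.lookup m X21)"] exI[of _ 0])
          (simp add: mult_ac)
    next
      case 2
      then show ?thesis unfolding eq
        by (intro CollectI exI[of _ "?rest * (Var X20 ^ Poly_Mapping.lookup m X20 * Var X21 ^ j)"] exI[of _ 0])
          (simp add: mult_ac)
    qed
  qed
  ultimately have "(\<Sum>m\<in>Poly_Mapping.keys p. Poly_Mapping.single m (Poly_Mapping.lookup p m)) \<in> ?T"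
    using assms by (intro idealD(4)) (auto simp: irrelevant_x_def)
  then show ?thesis by (simp only: mpoly_eq_sum_single[symmetric]) blast
qed

text \<open>
  Hence an element is in the saturation as soon as its products with $x_{2,0}$ and with some power of
  $x_{2,1}$ are in the ideal.
\<close>

lemma ideal_pow_irrelevant_x_member:
  fixes g :: "(xvar, 'k::comm_ring_1) mpoly"
  assumes "g \<in> ideal_pow irrelevant_x n"
  shows "\<exists>c e. g = c * Var X20 + e * Var X21 ^ n"
  using assms
proof (induction n arbitrary: g)
  case 0
  show ?case by (intro exI[of _ 0] exI[of _ g]) simp
next
  case (Suc n)
  let ?T = "{g :: (xvar, 'k) mpoly. \<exists>c e. g = c * Var X20 + e * Var X21 ^ Suc n}"
  have "is_ideal ?T"
    by (rule is_ideal_two_gens)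
  moreover have "x * y \<in> ?T" if xy: "x \<in> irrelevant_x" "y \<in> ideal_pow irrelevant_x n" for x y :: "(xvar, 'k) mpoly"
  proof -
    obtain c e where x: "x = c * Var X20 + e * Var X21" using irrelevant_x_member[OF xy(1)] by blast
    obtain c' e' where y: "y = c' * Var X20 + e' * Var X21 ^ n" using Suc.IH[OF xy(2)] by blast
    have "x * y = (c * y + e * c' * Var X21) * Var X20 + (e * e') * Var X21 ^ Suc n"
      by (simp add: x) (simp add: y algebra_simps)
    then show ?thesis by blast
  qed
  then have "{a * b | a b :: (xvar, 'k) mpoly. a \<in> irrelevant_x \<and> b \<in> ideal_pow irrelevant_x n} \<subseteq> ?T"
    by blast
  ultimately have "ideal_pow irrelevant_x (Suc n) \<subseteq> ?T"
    unfolding ideal_pow.simps by (intro ideal_minimal)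
  then show ?case using Suc.prems by blast
qed

lemma power_in_ideal_pow: "g \<in> J \<Longrightarrow> g ^ n \<in> ideal_pow J n"
  by (induction n) (auto intro!: ideal_base)

lemma subset_saturation:
  assumes "is_ideal I"
  shows "I \<subseteq> saturation I J"
proof
  fix p assume "p \<in> I"
  then have "p \<in> colon I (ideal_pow J 0)"
    using idealD(3)[OF assms, of p] by (simp add: colon_def mult.commute)
  then show "p \<in> saturation I J" unfolding saturation_def by blast
qed

lemma xy_in_irrelevant_x:
  assumes "u \<in> {X10, X11}" "v \<in> {X20, X21}"
  shows "Var u * Var v \<in> irrelevant_x"
  using assms by (auto simp: irrelevant_x_def Var_def mult_single bideg_def lookup_add lookup_single)

text \<open>
  If \<open>\<pi>\<close> is not a unit, the zero scheme contains the locus \<open>\<pi> = 0\<close>, on which the point of the first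
  projective line is arbitrary. In the chart the powers of its coordinate would then be linearly independent modulo the ideal. The
  tuple \<open>(y0, y1, v)\<close> selects one of the two charts of the second projective line.
\<close>

lemma finite_zero_scheme_no_common_factor:
  fixes f :: "zvar \<Rightarrow> (xvar, 'k::field) mpoly"
  assumes fin: "zero_scheme_finite (base_ideal f)"
    and f: "\<And>i. f i = xform d (a i) (b i)"
    and chart: "(y0, y1, v) \<in> {([:0, 1:], 1, X21), (1, [:0, 1:], X20)}"
    and dvd: "\<And>i. \<pi> dvd bform (\<lambda>c. [:c:]) d (a i) y0 y1" "\<And>i. \<pi> dvd bform (\<lambda>c. [:c:]) d (b i) y0 y1"
  shows "\<pi> dvd (1 :: 'k poly)"
proof -
  define J where "J = ideal_gen (base_ideal f \<union> {Var X10 - 1, Var v - 1})"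
  have "quotient_finite_dim J"
    using fin chart unfolding zero_scheme_finite_def J_def by auto
  then obtain S where S: "finite S" "K_span (S \<union> J) = UNIV" by (auto simp: quotient_finite_dim_def)
  define \<kappa> :: "'k \<Rightarrow> 'k poly poly" where "\<kappa> = (\<lambda>c. [:[:c:]:])"
  have \<kappa>: "coeff_hom \<kappa>" unfolding \<kappa>_def by (intro coeff_hom_pCons coeff_hom_const_poly)
  define \<sigma> where "\<sigma> = case_xvar 1 [:0, 1:] [:y0:] [:y1:]"
  define \<chi> where "\<chi> = ev \<kappa> \<sigma>"
  have \<chi>: "coeff_hom \<chi>" unfolding \<chi>_def by (rule coeff_hom_ev[OF \<kappa>])
  have bform_\<kappa>: "bform \<kappa> d p [:y0:] [:y1:] = [:bform (\<lambda>c. [:c:]) d p y0 y1:]" for p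
    using bform_hom[OF coeff_hom_const_poly, of "\<lambda>c. [:c:]" d p y0 y1] by (simp add: \<kappa>_def)
  have "\<chi> (f i) \<in> {x. [:\<pi>:] dvd x}" for i
    unfolding \<chi>_def f ev_form[OF \<kappa>]
    by (simp add: form_def \<sigma>_def bform_\<kappa> const_poly_dvd_iff coeff_pCons dvd split: nat.split)
  then have "base_ideal f \<subseteq> {p. \<chi> p \<in> {x. [:\<pi>:] dvd x}}"
    unfolding base_ideal_def by (intro ideal_minimal is_ideal_vimage[OF \<chi>] is_ideal_multiples) auto
  moreover have "\<chi> (Var X10 - 1) = 0" "\<chi> (Var v - 1) = 0"
    using chart unfolding \<chi>_def by (auto simp: ev_simps[OF \<kappa>] \<sigma>_def one_pCons)
  ultimately have J: "J \<subseteq> {p. \<chi> p \<in> {x. [:\<pi>:] dvd x}}"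
    unfolding J_def by (intro ideal_minimal is_ideal_vimage[OF \<chi>] is_ideal_multiples) auto
  \<comment> \<open>A power beyond all degrees that occur in the finite part of the spanning set.\<close>
  define N where "N = Suc (Max (insert 0 (degree ` \<chi> ` S)))"
  have N: "degree (\<chi> s) < N" if "s \<in> S" for s
    using that S(1) by (simp add: N_def less_Suc_eq_le)
  let ?T = "{p. \<pi> dvd coeff (\<chi> p) N}"
  interpret K: module "\<lambda>c p. Const c * p :: (xvar, 'k) mpoly"
    by unfold_locales (simp_all add: coeff_homD[OF coeff_hom_Const] algebra_simps)
  have \<chi>_Const: "\<chi> (Const c * p) = smult [:c:] (\<chi> p)" for c p
    unfolding \<chi>_def ev_mult[OF \<kappa>] ev_Const[OF \<kappa>] by (simp add: \<kappa>_def)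
  have "K.subspace ?T"
    unfolding K.subspace_def
    by (auto simp: coeff_homD(1,3)[OF \<chi>] \<chi>_Const intro: dvd_smult)
  moreover have "S \<union> J \<subseteq> ?T"
    using J N by (auto simp: coeff_eq_0 const_poly_dvd_iff)
  ultimately have "K_span (S \<union> J) \<subseteq> ?T" by (intro K.span_minimal)
  then have "Var X11 ^ N \<in> ?T" using S(2) by blast
  moreover have "\<chi> (Var X11 ^ N) = monom 1 N"
    by (simp add: \<chi>_def ev_simps[OF \<kappa>] \<sigma>_def monom_altdef)
  ultimately show ?thesis by simp
qed

section \<open>Linear syzygies\<close>

definition lincomb :: "(zvar \<Rightarrow> 'k::field) \<Rightarrow> (zvar \<Rightarrow> 'k poly) \<Rightarrow> 'k poly" where
  "lincomb c a = (\<Sum>i\<in>UNIV. smult (c i) (a i))"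

text \<open>
  This says $(x_{2,1}\,u - x_{2,0}\,v) \cdot f = 0$ in terms of the coefficient vectors \<open>a\<close>, \<open>b\<close> of
  the \<open>f i\<close>, dehomogenised at $x_{2,1} = 1$.
\<close>

definition linear_syzygy ::
  "(zvar \<Rightarrow> 'k::field poly) \<Rightarrow> (zvar \<Rightarrow> 'k poly) \<Rightarrow> (zvar \<Rightarrow> 'k) \<Rightarrow> (zvar \<Rightarrow> 'k) \<Rightarrow> bool" where
  "linear_syzygy a b u v \<longleftrightarrow>
     (\<exists>i. u i \<noteq> 0) \<and> lincomb u a = [:0, 1:] * lincomb v a \<and> lincomb u b = [:0, 1:] * lincomb v b"

lemma degree_lincomb: "(\<And>i. degree (a i) \<le> n) \<Longrightarrow> degree (lincomb c a) \<le> n"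
  unfolding lincomb_def by (rule degree_sum_le) (auto simp: UNIV_zvar intro: order.trans[OF degree_smult_le])

lemma degree_X_mult_le:
  assumes "degree ([:0, 1:] * p) \<le> n"
  shows "degree (p :: 'k::field poly) \<le> n - 1"
  using assms by (cases "p = 0") (auto simp: degree_pCons_eq)

text \<open>
  Independent vectors \<open>u\<close>, \<open>v\<close> form a basis of the three-dimensional space together with a unit vector
  \<open>k\<close>. The statement expresses the other unit vectors in this basis, in the form in which they act on
  vectors of polynomials.
\<close>

lemma complete_to_basis:
  fixes u v :: "zvar \<Rightarrow> 'k::field"
  assumes "u i * v j \<noteq> u j * v i"
  shows "\<exists>k. \<forall>l. \<exists>r s t. \<forall>a. a l = smult r (lincomb u a) + smult s (lincomb v a) + smult t (a k)"
proof -
  have "\<exists>k. k \<noteq> i \<and> k \<noteq> j" by (cases i; cases j) (metis zvar.distinct)+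
  then obtain k where k: "k \<noteq> i" "k \<noteq> j" by blast
  have ij: "i \<noteq> j" using assms by auto
  have split: "(\<Sum>m\<in>UNIV. g m) = g i + g j + g k" for g :: "zvar \<Rightarrow> 'k poly"
    using ij k by (cases i; cases j; cases k) (simp_all add: sum_zvar add_ac)
  define D where "D = u i * v j - u j * v i"
  have D: "D \<noteq> 0" using assms by (simp add: D_def)
  have i_eq: "a i = smult (v j / D) (lincomb u a) + smult (- u j / D) (lincomb v a)
      + smult ((u j * v k - v j * u k) / D) (a k)" for a
  proof -
    have "smult D (a i) = smult (v j) (lincomb u a) - smult (u j) (lincomb v a) + smult (u j * v k - v j * u k) (a k)"
      by (simp add: lincomb_def split D_def smult_add_right smult_diff_left algebra_simps)
    then have "smult (1 / D) (smult D (a i)) = smult (1 / D) (smult (v j) (lincomb u a) - smult (u j) (lincomb v a)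
        + smult (u j * v k - v j * u k) (a k))" by simp
    then show ?thesis using D by (simp add: smult_add_right smult_diff_right)
  qed
  have j_eq: "a j = smult (- v i / D) (lincomb u a) + smult (u i / D) (lincomb v a)
      + smult ((v i * u k - u i * v k) / D) (a k)" for a
  proof -
    have "smult D (a j) = smult (u i) (lincomb v a) - smult (v i) (lincomb u a) + smult (v i * u k - u i * v k) (a k)"
      by (simp add: lincomb_def split D_def smult_add_right smult_diff_left algebra_simps)
    then have "smult (1 / D) (smult D (a j)) = smult (1 / D) (smult (u i) (lincomb v a) - smult (v i) (lincomb u a)
        + smult (v i * u k - u i * v k) (a k))" by simp
    then show ?thesis using D by (simp add: smult_add_right smult_diff_right)
  qed
  have "\<exists>r s t. \<forall>a. a l = smult r (lincomb u a) + smult s (lincomb v a) + smult t (a k)" for l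
  proof -
    have "l = i \<or> l = j \<or> l = k" using ij k by (cases i; cases j; cases k; cases l) auto
    then show ?thesis
    proof (elim disjE)
      assume "l = k"
      then show ?thesis by (intro exI[of _ 0] exI[of _ 1]) simp
    qed (use i_eq j_eq in blast)+
  qed
  then show ?thesis by blast
qed

lemma unimodular_nonzero_at_0:
  fixes q r :: "zvar \<Rightarrow> 'k::field poly"
  assumes "(\<Sum>i\<in>UNIV. r i * q i) = 1"
  shows "\<exists>i. coeff (q i) 0 \<noteq> 0"
proof (rule ccontr)
  assume "\<not> ?thesis"
  then have "poly (q i) 0 = 0" for i by (simp add: poly_0_coeff_0)
  then have "poly (\<Sum>i\<in>UNIV. r i * q i) 0 = 0" by (simp add: poly_sum)
  then show False using assms by simp
qed

text \<open>
  If all minors vanish, then \<open>f\<close> is proportional to a vector \<open>w\<close> of three binary forms of degree \<open>d\<close>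
  (one of \<open>a\<close>, \<open>b\<close>), so the image is a curve parametrised by \<open>w\<close>. The forms of degree \<open>2 m\<close> in \<open>z\<close>
  restrict to binary forms of degree \<open>2 m d\<close> on this curve. The space of the former grows
  quadratically in \<open>m\<close> and the space of the latter linearly, so some nonzero form \<open>H\<close> vanishes on the
  curve. Then \<open>H\<close> is in the kernel of the substitution.
\<close>

lemma minors_nonzero:
  fixes f :: "zvar \<Rightarrow> (xvar, 'k::field) mpoly"
  assumes f: "\<And>i. f i = xform d (a i) (b i)"
    and deg: "\<And>i. degree (a i) \<le> d" "\<And>i. degree (b i) \<le> d"
    and inj: "\<And>h. subst f h = 0 \<Longrightarrow> h = 0"
  shows "\<exists>i j. a i * b j \<noteq> a j * b i"
proof (rule ccontr)
  assume "\<not> ?thesis"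
  then have minors: "a i * b j = a j * b i" for i j by blast
  note \<kappa> = coeff_hom_Const[where 'a = 'k and 'b = xvar]
  define F where "F p = bform Const d p (Var X20) (Var X21 :: (xvar, 'k) mpoly)" for p
  have f': "f i = Var X10 * F (a i) + Var X11 * F (b i)" for i
    by (simp add: f form_def F_def)
  have FF: "F (a i) * F (b j) = F (a j) * F (b i)" for i j
    using minors[of i j] deg bform_mult[OF \<kappa>, of "a i" d "b j" d] bform_mult[OF \<kappa>, of "a j" d "b i" d]
    by (simp add: F_def)
  have f0: "f i \<noteq> 0" for i
    using inj[of "Var i"] Var_neq_0[of i, where 'k = 'k] by (auto simp: subst_eq_ev ev_Var[OF \<kappa>])
  obtain w j where w: "\<And>i. degree (w i) \<le> d" "F (w j) \<noteq> 0" "\<And>i. f i * F (w j) = f j * F (w i)"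
  proof (cases "F (a Z0) = 0")
    case True
    then have "F (b Z0) \<noteq> 0" using f0[of Z0] f'[of Z0] by auto
    moreover have "f i * F (b Z0) = f Z0 * F (b i)" for i
      using FF[of i Z0] by (simp add: f' algebra_simps)
    ultimately show thesis using that[of b Z0] deg by blast
  next
    case False
    moreover have "f i * F (a Z0) = f Z0 * F (a i)" for i
      using FF[of i Z0] by (simp add: f' algebra_simps)
    ultimately show thesis using that[of a Z0] deg by blast
  qed
  \<comment> \<open>With exponents \<open>i, j \<le> m\<close> there are \<open>(m + 1)\<^sup>2\<close> monomials, and this value of \<open>m\<close> makes that exceed \<open>2 * m * d + 1\<close>.\<close>
  define m where "m = 2 * d + 1"
  define I where "I = {..m} \<times> {..m}"
  define e where "e = (\<lambda>(i, j). w Z0 ^ i * w Z1 ^ j * w Z2 ^ (2 * m - i - j))"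
  have wpow: "degree (w i ^ k) \<le> k * d" for i k
    by (rule degree_power_bound[OF w(1)])
  have edeg: "degree (w Z0 ^ i * w Z1 ^ j * w Z2 ^ k) \<le> i * d + j * d + k * d"
    "degree (w Z0 ^ i * w Z1 ^ j) \<le> i * d + j * d" for i j k
    by (intro order.trans[OF degree_mult_le] add_mono wpow)+
  have split: "2 * m * d = i * d + j * d + (2 * m - i - j) * d" if "(i, j) \<in> I" for i j
    using that by (simp add: I_def add_mult_distrib[symmetric])
  have deg_e: "degree (e x) \<le> 2 * m * d" if "x \<in> I" for x
    using that edeg(1) split by (cases x) (auto simp: e_def)
  have "Suc (2 * m * d) < card I"
    by (simp add: I_def m_def algebra_simps power2_eq_square)
  then obtain c where c: "\<exists>x\<in>I. c x \<noteq> 0" "(\<Sum>x\<in>I. smult (c x) (e x)) = 0"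
    using smult_dependent[of I e "2 * m * d"] deg_e by (auto simp: I_def)
  define \<mu> where "\<mu> = (\<lambda>(i, j). Poly_Mapping.single Z0 i + Poly_Mapping.single Z1 j
      + Poly_Mapping.single Z2 (2 * m - i - j))"
  have lookup_\<mu>: "Poly_Mapping.lookup (\<mu> (i, j)) Z0 = i" "Poly_Mapping.lookup (\<mu> (i, j)) Z1 = j"
    "Poly_Mapping.lookup (\<mu> (i, j)) Z2 = 2 * m - i - j" for i j
    by (auto simp: \<mu>_def lookup_add lookup_single)
  have inj_\<mu>: "\<mu> x = \<mu> y \<longleftrightarrow> x = y" for x y
    by (cases x; cases y) (metis lookup_\<mu>(1,2))
  define H :: "(zvar, 'k) mpoly" where "H = (\<Sum>x\<in>I. Poly_Mapping.single (\<mu> x) (c x))"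
  have "Poly_Mapping.lookup H (\<mu> x) = (\<Sum>y\<in>I. if y = x then c y else 0)" for x
    unfolding H_def lookup_sum by (intro sum.cong) (auto simp: lookup_single when_def inj_\<mu>)
  then have "Poly_Mapping.lookup H (\<mu> x) = c x" if "x \<in> I" for x
    using that by (simp add: I_def)
  then have "H \<noteq> 0" using c(1) by force
  have homog_H: "homog tdeg (2 * m) H"
    unfolding H_def by (intro homog_sum homog_single) (auto simp: I_def tdeg_def lookup_\<mu>)
  have "ev Const (\<lambda>i. F (w i)) H = (\<Sum>x\<in>I. Const (c x) * bform Const (2 * m * d) (e x) (Var X20) (Var X21))"
    unfolding H_def ev_sum[OF \<kappa>] ev_single[OF \<kappa>]
  proof (intro sum.cong refl)
    fix x assume "x \<in> I"
    obtain i j where x: "x = (i, j)" by (cases x)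
    have "F (w Z0) ^ i * F (w Z1) ^ j * F (w Z2) ^ (2 * m - i - j)
        = bform Const (2 * m * d) (e x) (Var X20) (Var X21)"
      using split[of i j] \<open>x \<in> I\<close> unfolding x
      by (simp only:) (simp add: F_def e_def bform_mult[OF \<kappa>] bform_power[OF \<kappa>] wpow edeg w(1))
    then show "Const (c x) * evm (\<lambda>i. F (w i)) (\<mu> x)
        = Const (c x) * bform Const (2 * m * d) (e x) (Var X20) (Var X21)"
      by (simp add: evm_zvar x lookup_\<mu>)
  qed
  also have "\<dots> = bform Const (2 * m * d) (\<Sum>x\<in>I. smult (c x) (e x)) (Var X20) (Var X21)"
    by (simp add: bform_sum[OF \<kappa>] bform_smult[OF \<kappa>])
  also have "\<dots> = 0" by (simp add: c(2) bform_0[OF \<kappa>])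
  finally have "ev Const (\<lambda>i. F (w i)) H = 0" .
  \<comment> \<open>Homogeneity of \<open>H\<close> turns the proportionality of \<open>f\<close> and \<open>w\<close> into one of the values of \<open>H\<close>.\<close>
  then have "F (w j) ^ (2 * m) * subst f H = 0"
    using ev_homog_scale[OF \<kappa> homog_H, of "F (w j)" f]
      ev_homog_scale[OF \<kappa> homog_H, of "f j" "\<lambda>i. F (w i)"] w(3)
    by (simp add: subst_eq_ev mult.commute)
  then have "subst f H = 0" using w(2) by simp
  then show False using inj \<open>H \<noteq> 0\<close> by blast
qed

context
  fixes f :: "zvar \<Rightarrow> (xvar, 'k::field) mpoly" and a b :: "zvar \<Rightarrow> 'k poly" and d :: nat
  assumes f: "\<And>i. f i = xform d (a i) (b i)"
    and deg: "\<And>i. degree (a i) \<le> d" "\<And>i. degree (b i) \<le> d"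
    and inj: "\<And>h. subst f h = 0 \<Longrightarrow> h = 0"
begin

lemma lincomb_f: "(\<Sum>i\<in>UNIV. Const (c i) * f i) = xform d (lincomb c a) (lincomb c b)"
  by (simp add: f form_sum[OF coeff_hom_Const] lincomb_def)

lemma f_independent:
  assumes "(\<Sum>i\<in>UNIV. Const (c i) * f i) = 0"
  shows "c i = 0"
proof -
  let ?H = "\<Sum>i\<in>UNIV. Const (c i) * Var i"
  have single_inj: "Poly_Mapping.single v (Suc 0) = Poly_Mapping.single w (Suc 0) \<longleftrightarrow> v = w" for v w :: zvar
    by (metis lookup_single_eq lookup_single_not_eq zero_neq_one One_nat_def)
  have "subst f ?H = 0"
    using assms by (simp add: subst_eq_ev ev_simps[OF coeff_hom_Const])
  then have "?H = 0" by (rule inj)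
  then have "Poly_Mapping.lookup ?H (Poly_Mapping.single i 1) = 0" by (simp only: lookup_zero)
  moreover have "Poly_Mapping.lookup ?H (Poly_Mapping.single i 1) = c i"
    by (cases i) (simp_all add: sum_zvar lookup_add Const_def Var_def mult_single lookup_single when_def single_inj)
  ultimately show ?thesis by simp
qed

text \<open>
  The vector $a \times b$ of minors is a syzygy, and \<open>q\<close> is what remains after removing the common factor \<open>c\<close>.
\<close>

lemma unimodular_syzygy:
  obtains c q r where "c \<noteq> 0"
    "a Z1 * b Z2 - a Z2 * b Z1 = c * q Z0"
    "a Z2 * b Z0 - a Z0 * b Z2 = c * q Z1"
    "a Z0 * b Z1 - a Z1 * b Z0 = c * q Z2"
    "(\<Sum>i\<in>UNIV. r i * q i) = 1"
    "(\<Sum>i\<in>UNIV. q i * a i) = 0" "(\<Sum>i\<in>UNIV. q i * b i) = 0"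
proof -
  let ?p = "case_zvar (a Z1 * b Z2 - a Z2 * b Z1) (a Z2 * b Z0 - a Z0 * b Z2) (a Z0 * b Z1 - a Z1 * b Z0)"
  have "\<exists>i. ?p i \<noteq> 0"
  proof (rule ccontr)
    assume "\<not> ?thesis"
    then have *: "?p i = 0" for i by blast
    have "a i * b j = a j * b i" for i j
      using *[of Z0] *[of Z1] *[of Z2] by (cases i; cases j) auto
    then show False using minors_nonzero[where f = f and a = a and b = b and d = d] f deg inj by blast
  qed
  then obtain c q r where cqr: "c \<noteq> 0" "\<And>i. ?p i = c * q i" "(\<Sum>i\<in>UNIV. r i * q i) = 1"
    by (rule common_factor) blast
  have p: "a Z1 * b Z2 - a Z2 * b Z1 = c * q Z0" "a Z2 * b Z0 - a Z0 * b Z2 = c * q Z1"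
    "a Z0 * b Z1 - a Z1 * b Z0 = c * q Z2"
    using cqr(2)[of Z0] cqr(2)[of Z1] cqr(2)[of Z2] by simp_all
  have "c * (\<Sum>i\<in>UNIV. q i * a i) = 0" "c * (\<Sum>i\<in>UNIV. q i * b i) = 0"
    unfolding sum_zvar distrib_left mult.assoc[symmetric] p[symmetric] by (simp_all add: algebra_simps)
  then have "(\<Sum>i\<in>UNIV. q i * a i) = 0" "(\<Sum>i\<in>UNIV. q i * b i) = 0"
    using cqr(1) by simp_all
  with cqr(1) p cqr(3) show thesis by (rule that)
qed

text \<open>
  With $q = -u + Y q'$ the relation $q \cdot f = 0$ becomes $u \cdot f = Y (q' \cdot f)$. The
  dehomogenised form $q' \cdot f$ is used as a form \<open>P\<close> of bi-degree $(1, d)$. Then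
  $x_{2,0} P = x_{2,1} (u \cdot f)$ lies in the base ideal, and so does $x_{2,1}^M P$, which is the
  homogenisation of $q' \cdot f$. So \<open>P\<close> belongs to the saturation.
\<close>

lemma linear_syzygy_of_saturated:
  assumes sat: "component bideg (1, d) (base_ideal f)
    = component bideg (1, d) (saturation (base_ideal f) irrelevant_x)"
  shows "\<exists>u v. linear_syzygy a b u v"
proof -
  note \<kappa> = coeff_hom_Const[where 'a = 'k and 'b = xvar]
  obtain c q r where unimod: "(\<Sum>i\<in>UNIV. r i * q i) = 1"
    and qa: "(\<Sum>i\<in>UNIV. q i * a i) = 0" and qb: "(\<Sum>i\<in>UNIV. q i * b i) = 0"
    by (rule unimodular_syzygy)
  define u where "u i = - coeff (q i) 0" for i
  have "\<exists>q'. q i = pCons (- u i) q'" for i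
    by (cases "q i") (simp add: u_def)
  then obtain q' where q': "\<And>i. q i = pCons (- u i) (q' i)" by metis
  have u: "\<exists>i. u i \<noteq> 0"
    using unimodular_nonzero_at_0[OF unimod] by (simp add: u_def)
  define A B where "A = (\<Sum>i\<in>UNIV. q' i * a i)" and "B = (\<Sum>i\<in>UNIV. q' i * b i)"
  have key: "lincomb u g = [:0, 1:] * (\<Sum>i\<in>UNIV. q' i * g i)" if "(\<Sum>i\<in>UNIV. q i * g i) = 0" for g
    using that by (simp add: q' lincomb_def sum_zvar algebra_simps)
  have uA: "lincomb u a = [:0, 1:] * A" and uB: "lincomb u b = [:0, 1:] * B"
    unfolding A_def B_def by (rule key qa qb)+
  have "degree A \<le> d - 1" "degree B \<le> d - 1"
    using degree_lincomb[of a d u, OF deg(1)] degree_lincomb[of b d u, OF deg(2)] unfolding uA uB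
    by (simp_all only: degree_X_mult_le)
  then have dA: "degree A \<le> d" and dB: "degree B \<le> d" by simp_all
  define P where "P = xform d A B"
  \<comment> \<open>Any bound for the degrees of the \<open>q' i\<close> will do.\<close>
  define M where "M = degree (q' Z0) + degree (q' Z1) + degree (q' Z2)"
  have M: "degree (q' i) \<le> M" for i by (cases i) (simp_all add: M_def)
  note I = idealD[OF is_ideal_base_ideal[of f]]
  have "Var X20 * P = Var X21 * (\<Sum>i\<in>UNIV. Const (u i) * f i)"
    unfolding P_def lincomb_f form_X_mult[OF \<kappa> dA dB, of Var] uA[symmetric] uB[symmetric]
    by (rule form_Suc[OF \<kappa> degree_lincomb degree_lincomb, symmetric]) (rule deg)+
  then have y0: "Var X20 * P \<in> base_ideal f"
    by (auto intro!: I(3,4) base_ideal_gens)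
  have "Var X21 ^ M * P = xform (M + d) A B"
    unfolding P_def by (rule form_power_mult[OF \<kappa> dA dB])
  also have "\<dots> = (\<Sum>i\<in>UNIV. xform (M + d) (q' i * a i) (q' i * b i))"
    unfolding A_def B_def by (rule form_sum_forms[OF \<kappa>, symmetric])
  also have "\<dots> = (\<Sum>i\<in>UNIV. bform Const M (q' i) (Var X20) (Var X21) * f i)"
    unfolding f by (simp only: form_mult[OF \<kappa> M deg, where s = Var])
  finally have "Var X21 ^ M * P = (\<Sum>i\<in>UNIV. bform Const M (q' i) (Var X20) (Var X21) * f i)" .
  then have y1: "Var X21 ^ M * P \<in> base_ideal f"
    by (auto intro!: I(3,4) base_ideal_gens)
  have "P \<in> colon (base_ideal f) (ideal_pow irrelevant_x M)"
    unfolding colon_def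
  proof (intro CollectI ballI)
    fix g :: "(xvar, 'k) mpoly" assume "g \<in> ideal_pow irrelevant_x M"
    then obtain c e where "g = c * Var X20 + e * Var X21 ^ M"
      using ideal_pow_irrelevant_x_member by blast
    then have "P * g = c * (Var X20 * P) + e * (Var X21 ^ M * P)" by (simp add: algebra_simps)
    then show "P * g \<in> base_ideal f" using I(2)[OF I(3)[OF y0] I(3)[OF y1]] by simp
  qed
  then have "P \<in> component bideg (1, d) (saturation (base_ideal f) irrelevant_x)"
    unfolding component_def saturation_def using homog_xform[of d A B] by (auto simp: P_def)
  then have "P \<in> base_ideal f" "homog bideg (1, d) P"
    unfolding sat[symmetric] by (auto simp: component_def)
  moreover have "homog bideg (1, d) (f i)" for i unfolding f by (rule homog_xform)
  ultimately obtain v where "P = (\<Sum>i\<in>UNIV. Const (v i) * f i)"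
    using homog_in_base_ideal[of "(1, d)" f P] by blast
  then have "xform d A B = xform d (lincomb v a) (lincomb v b)" by (simp add: P_def lincomb_f)
  note inject = xform_inject[OF dA dB degree_lincomb[of a d v, OF deg(1)] degree_lincomb[of b d v, OF deg(2)] this]
  have "linear_syzygy a b u v"
    unfolding linear_syzygy_def inject[symmetric] using u uA uB by blast
  then show ?thesis by blast
qed

text \<open>
  The polynomial \<open>h w\<close> expresses that the inverse map recovers the parameter \<open>Y\<close> of the line through the
  point \<open>w\<close>. It vanishes at points of the plane $q \cdot w = 0$, because up to a nonzero factor these
  are combinations of $a(Y)$ and $b(Y)$. The point \<open>z\<close> with coordinates $f_i$ does not depend on \<open>Y\<close>, and
  subtracting $(q \cdot z)\,r$, where $r \cdot q = 1$, projects it to the plane. Hence $q \cdot z$ divides \<open>h z\<close>,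
  which is nonzero of degree at most one in \<open>Y\<close>. As the $f_i$ are linearly independent,
  the degree of $q \cdot z$ is the degree of \<open>q\<close>.
\<close>

lemma linear_syzygy_of_inverse:
  assumes g: "homog tdeg n (g X20)" "homog tdeg n (g X21)"
    and same: "same_coords {X20, X21} (\<lambda>v. subst f (g v)) Var"
  shows "\<exists>u v. linear_syzygy a b u v"
proof -
  obtain c q r where c: "c \<noteq> 0"
    and minors: "a Z1 * b Z2 - a Z2 * b Z1 = c * q Z0" "a Z2 * b Z0 - a Z0 * b Z2 = c * q Z1"
      "a Z0 * b Z1 - a Z1 * b Z0 = c * q Z2"
    and unimod: "(\<Sum>i\<in>UNIV. r i * q i) = 1"
    and qa: "(\<Sum>i\<in>UNIV. q i * a i) = 0" and qb: "(\<Sum>i\<in>UNIV. q i * b i) = 0"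
    by (rule unimodular_syzygy)
  define \<kappa> :: "'k \<Rightarrow> (xvar, 'k) mpoly poly" where "\<kappa> = (\<lambda>c. [:Const c:])"
  have hom: "coeff_hom \<kappa>" unfolding \<kappa>_def by (intro coeff_hom_pCons coeff_hom_Const)
  define \<iota> :: "'k poly \<Rightarrow> (xvar, 'k) mpoly poly" where "\<iota> = map_poly Const"
  have hom_\<iota>: "coeff_hom \<iota>" unfolding \<iota>_def by (rule map_poly_coeff_hom[OF coeff_hom_Const])
  have Const_eq_0: "Const x = (0 :: (xvar, 'k) mpoly) \<longleftrightarrow> x = 0" for x
    by (metis Const_def lookup_single_eq lookup_zero single_zero)
  have \<iota>_nz: "\<iota> p \<noteq> 0" if "p \<noteq> 0" for p
    using that by (auto simp: \<iota>_def map_poly_eq_0_iff Const_eq_0)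
  let ?Y = "[:0, 1:] :: (xvar, 'k) mpoly poly"
  define h where "h w = ev \<kappa> w (g X20) - ?Y * ev \<kappa> w (g X21)" for w
  have rel: "subst f (g X20) * Var X21 = subst f (g X21) * Var X20"
    using same unfolding same_coords_def by blast
  \<comment> \<open>The points of the line with parameter \<open>Y\<close>: the chart $x_{2,0} = Y$, $x_{2,1} = 1$.\<close>
  have h_image: "h (\<lambda>i. x0 * \<iota> (a i) + x1 * \<iota> (b i)) = 0" for x0 x1
  proof -
    define \<sigma> where "\<sigma> = case_xvar x0 x1 ?Y 1"
    have "ev \<kappa> \<sigma> (f i) = x0 * \<iota> (a i) + x1 * \<iota> (b i)" for i
      using bform_affine_map[OF coeff_hom_Const[where 'a = 'k and 'b = xvar], OF deg(1)[of i]]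
        bform_affine_map[OF coeff_hom_Const[where 'a = 'k and 'b = xvar], OF deg(2)[of i]]
      unfolding f ev_form[OF hom] by (simp add: form_def \<sigma>_def \<kappa>_def \<iota>_def)
    then have "ev \<kappa> \<sigma> (subst f (g v)) = ev \<kappa> (\<lambda>i. x0 * \<iota> (a i) + x1 * \<iota> (b i)) (g v)" for v
      by (simp add: ev_subst[OF hom])
    moreover have "ev \<kappa> \<sigma> (subst f (g X20)) * \<sigma> X21 = ev \<kappa> \<sigma> (subst f (g X21)) * \<sigma> X20"
      using arg_cong[OF rel, of "ev \<kappa> \<sigma>"] by (simp add: ev_mult[OF hom] ev_Var[OF hom])
    ultimately show ?thesis by (simp add: h_def \<sigma>_def mult.commute)
  qed
  have h_plane: "h w = 0" if w: "(\<Sum>i\<in>UNIV. \<iota> (q i) * w i) = 0" for w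
  proof -
    have m: "\<iota> (a Z1) * \<iota> (b Z2) - \<iota> (a Z2) * \<iota> (b Z1) = \<iota> c * \<iota> (q Z0)"
      "\<iota> (a Z2) * \<iota> (b Z0) - \<iota> (a Z0) * \<iota> (b Z2) = \<iota> c * \<iota> (q Z1)"
      "\<iota> (a Z0) * \<iota> (b Z1) - \<iota> (a Z1) * \<iota> (b Z0) = \<iota> c * \<iota> (q Z2)"
      using minors[THEN arg_cong[where f = \<iota>]] by (simp_all add: coeff_homD[OF hom_\<iota>])
    have E: "(\<iota> (a Z1) * \<iota> (b Z2) - \<iota> (a Z2) * \<iota> (b Z1)) * w Z0
        + (\<iota> (a Z2) * \<iota> (b Z0) - \<iota> (a Z0) * \<iota> (b Z2)) * w Z1
        + (\<iota> (a Z0) * \<iota> (b Z1) - \<iota> (a Z1) * \<iota> (b Z0)) * w Z2 = 0"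
      using arg_cong[OF w, of "\<lambda>x. \<iota> c * x"] unfolding m
      by (simp add: sum_zvar distrib_left mult.assoc)
    obtain i where "coeff (q i) 0 \<noteq> 0" using unimodular_nonzero_at_0[OF unimod] by blast
    then have "q i \<noteq> 0" by auto
    then have nz: "\<iota> c * \<iota> (q i) \<noteq> 0" using c \<iota>_nz by simp
    obtain x0 x1 where x: "\<And>l. \<iota> c * \<iota> (q i) * w l = x0 * \<iota> (a l) + x1 * \<iota> (b l)"
    proof (cases i)
      case Z0
      have "\<iota> c * \<iota> (q i) * w l = (w Z1 * \<iota> (b Z2) - w Z2 * \<iota> (b Z1)) * \<iota> (a l)
          + (\<iota> (a Z1) * w Z2 - \<iota> (a Z2) * w Z1) * \<iota> (b l)" for l
        unfolding Z0 m[symmetric] by (rule plane_spanned(1)[OF E])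
      then show thesis by (rule that)
    next
      case Z1
      have "\<iota> c * \<iota> (q i) * w l = (w Z2 * \<iota> (b Z0) - w Z0 * \<iota> (b Z2)) * \<iota> (a l)
          + (\<iota> (a Z2) * w Z0 - \<iota> (a Z0) * w Z2) * \<iota> (b l)" for l
        unfolding Z1 m[symmetric] by (rule plane_spanned(2)[OF E])
      then show thesis by (rule that)
    next
      case Z2
      have "\<iota> c * \<iota> (q i) * w l = (w Z0 * \<iota> (b Z1) - w Z1 * \<iota> (b Z0)) * \<iota> (a l)
          + (\<iota> (a Z0) * w Z1 - \<iota> (a Z1) * w Z0) * \<iota> (b l)" for l
        unfolding Z2 m[symmetric] by (rule plane_spanned(3)[OF E])
      then show thesis by (rule that)
    qed
    have "(\<iota> c * \<iota> (q i)) ^ n * h w = h (\<lambda>l. \<iota> c * \<iota> (q i) * w l)"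
      unfolding h_def ev_homog_scale[OF hom g(1)] ev_homog_scale[OF hom g(2)]
      by (simp add: algebra_simps)
    also have "\<dots> = 0" unfolding x by (rule h_image)
    finally show ?thesis using nz by simp
  qed
  define z where "z i = [:f i:]" for i
  define Q where "Q = (\<Sum>i\<in>UNIV. \<iota> (q i) * z i)"
  \<comment> \<open>The projection of \<open>z\<close> to the plane along \<open>r\<close>.\<close>
  define w where "w i = z i - Q * \<iota> (r i)" for i
  have "(\<Sum>i\<in>UNIV. \<iota> (q i) * w i) = Q - Q * (\<Sum>i\<in>UNIV. \<iota> (r i) * \<iota> (q i))"
    by (simp add: w_def Q_def sum_zvar algebra_simps)
  also have "(\<Sum>i\<in>UNIV. \<iota> (r i) * \<iota> (q i)) = 1"
    using arg_cong[OF unimod, of \<iota>] by (simp add: coeff_homD[OF hom_\<iota>])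
  finally have "h w = 0" by (intro h_plane) simp
  have "Q dvd z i - w i" for i by (simp add: w_def)
  then have dvd: "Q dvd ev \<kappa> z (g v) - ev \<kappa> w (g v)" for v by (rule ev_diff_dvd[OF hom])
  have "Q dvd (ev \<kappa> z (g X20) - ev \<kappa> w (g X20)) - ?Y * (ev \<kappa> z (g X21) - ev \<kappa> w (g X21))"
    by (rule dvd_diff[OF dvd dvd_mult[OF dvd]])
  also have "\<dots> = h z - h w" by (simp add: h_def algebra_simps)
  finally have "Q dvd h z" by (simp add: \<open>h w = 0\<close>)
  have "ev \<kappa> z (g v) = [:subst f (g v):]" for v
    using ev_hom[OF coeff_hom_const_poly, of Const f "g v"]
    by (simp add: z_def[abs_def] \<kappa>_def subst_eq_ev)
  then have hz: "h z = [:subst f (g X20), - subst f (g X21):]" by (simp add: h_def)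
  have "h z \<noteq> 0" using same by (auto simp: hz same_coords_def)
  then have "degree Q \<le> degree (h z)" using \<open>Q dvd h z\<close> by (intro dvd_imp_degree_le)
  also have "\<dots> \<le> 1" by (simp add: hz)
  finally have "degree Q \<le> 1" .
  have "coeff (q i) k = 0" if "k > 1" for i k
  proof (rule f_independent)
    have "coeff Q k = (\<Sum>i\<in>UNIV. Const (coeff (q i) k) * f i)"
      by (simp add: Q_def coeff_sum z_def \<iota>_def coeff_map_poly coeff_homD[OF coeff_hom_Const] mult.commute)
    then show "(\<Sum>i\<in>UNIV. Const (coeff (q i) k) * f i) = 0"
      using \<open>degree Q \<le> 1\<close> that by (simp add: coeff_eq_0)
  qed
  then have q: "q i = [:coeff (q i) 0, coeff (q i) 1:]" for i
    by (intro poly_eqI) (auto simp: coeff_pCons split: nat.split)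
  define u v where "u i = coeff (q i) 0" and "v i = - coeff (q i) 1" for i
  have "\<exists>i. u i \<noteq> 0" using unimodular_nonzero_at_0[OF unimod] by (simp add: u_def)
  moreover have "lincomb u y = [:0, 1:] * lincomb v y" if "(\<Sum>i\<in>UNIV. q i * y i) = 0" for y
  proof -
    have "q i = [:u i, - v i:]" for i using q[of i] by (simp add: u_def v_def)
    then have "q i * y i = smult (u i) (y i) - [:0, 1:] * smult (v i) (y i)" for i
      by simp
    then have "(\<Sum>i\<in>UNIV. q i * y i) = lincomb u y - [:0, 1:] * lincomb v y"
      by (simp only: lincomb_def sum_subtractf sum_distrib_left)
    then show ?thesis using that by (metis right_minus_eq)
  qed
  ultimately have "linear_syzygy a b u v" using qa qb unfolding linear_syzygy_def by blast
  then show ?thesis by blast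
qed


section \<open>The normal form given by a linear syzygy\<close>

context
  fixes u v :: "zvar \<Rightarrow> 'k"
  assumes syz: "linear_syzygy a b u v"
begin

text \<open>
  If $v = c\,u$, the syzygy reads $(1 - c Y)(u \cdot f) = 0$, against the linear independence of the
  $f_i$.
\<close>

lemma syzygy_independent: "\<exists>i j. u i * v j \<noteq> u j * v i"
proof (rule ccontr)
  assume "\<not> ?thesis"
  then have minors: "u i * v j = u j * v i" for i j by blast
  obtain l where l: "u l \<noteq> 0" using syz by (auto simp: linear_syzygy_def)
  define c where "c = v l / u l"
  have "v i = c * u i" for i using minors[of l i] l by (simp add: c_def field_simps)
  then have v: "lincomb v y = smult c (lincomb u y)" for y
    by (simp add: lincomb_def sum_zvar smult_add_right)
  have "lincomb u y = 0" if "lincomb u y = [:0, 1:] * lincomb v y" for y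
  proof -
    have "[:1, - c:] * lincomb u y = lincomb u y - [:0, 1:] * lincomb v y"
      unfolding v by simp
    also have "\<dots> = 0" using that by simp
    finally show ?thesis by (simp del: mult_pCons_left)
  qed
  then have "lincomb u a = 0" "lincomb u b = 0" using syz by (auto simp: linear_syzygy_def)
  then have "(\<Sum>i\<in>UNIV. Const (u i) * f i) = 0"
    using lincomb_f[of u] by (simp add: form_def bform_0[OF coeff_hom_Const])
  then have "u l = 0" by (rule f_independent)
  with l show False by simp
qed

text \<open>
  In the basis \<open>u\<close>, \<open>v\<close>, \<open>k\<close> the map has the coordinates $u \cdot f = x_{2,0} h$,
  $v \cdot f = x_{2,1} h$ and $f_k$, where \<open>h\<close> has bi-degree $(1, e)$ and the coefficients
  \<open>lincomb v a\<close> and \<open>lincomb v b\<close>. All minors of \<open>a\<close> and \<open>b\<close> are multiples of the determinant of \<open>h\<close> and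
  $f_k$, which is therefore nonzero.
\<close>

lemma normal_form:
  obtains k e r s t where "d = Suc e"
    "degree (lincomb v a) \<le> e" "degree (lincomb v b) \<le> e"
    "\<And>l y. y l = smult (r l) (lincomb u y) + smult (s l) (lincomb v y) + smult (t l) (y k)"
    "lincomb v a * b k - a k * lincomb v b \<noteq> 0"
proof -
  obtain i j where "u i * v j \<noteq> u j * v i" using syzygy_independent by blast
  from complete_to_basis[OF this] obtain k r s t where
    basis: "y l = smult (r l) (lincomb u y) + smult (s l) (lincomb v y) + smult (t l) (y k)" for l and y :: "zvar \<Rightarrow> 'k poly"
    by metis
  have ua: "lincomb u a = [:0, 1:] * lincomb v a" and ub: "lincomb u b = [:0, 1:] * lincomb v b"
    using syz by (auto simp: linear_syzygy_def)
  have D: "lincomb v a * b k - a k * lincomb v b \<noteq> 0"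
  proof
    assume D: "lincomb v a * b k - a k * lincomb v b = 0"
    \<comment> \<open>As \<open>lincomb u\<close> is \<open>Y\<close> times \<open>lincomb v\<close>, these are the coordinates with respect to \<open>h\<close> and $f_k$.\<close>
    define p where "p l = [:s l, r l:]" for l
    have pa: "a l = p l * lincomb v a + smult (t l) (a k)" for l
      using basis[of a l] unfolding ua by (simp add: p_def algebra_simps)
    have pb: "b l = p l * lincomb v b + smult (t l) (b k)" for l
      using basis[of b l] unfolding ub by (simp add: p_def algebra_simps)
    have "a i * b j - a j * b i = 0" for i j
    proof -
      have "a i * b j - a j * b i
          = (p i * lincomb v a + smult (t i) (a k)) * (p j * lincomb v b + smult (t j) (b k))
          - (p j * lincomb v a + smult (t j) (a k)) * (p i * lincomb v b + smult (t i) (b k))"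
        by (simp only: pa[symmetric] pb[symmetric])
      also have "\<dots> = (smult (t j) (p i) - smult (t i) (p j)) * (lincomb v a * b k - a k * lincomb v b)"
        by (simp add: algebra_simps)
      finally show ?thesis by (simp add: D)
    qed
    then show False
      using minors_nonzero[where f = f and a = a and b = b and d = d] f deg inj by auto
  qed
  have "degree (lincomb v a) \<le> d - 1" "degree (lincomb v b) \<le> d - 1"
    using degree_lincomb[of a d u, OF deg(1)] degree_lincomb[of b d u, OF deg(2)] unfolding ua ub
    by (simp_all only: degree_X_mult_le)
  moreover have "d \<noteq> 0"
  proof
    assume "d = 0"
    have "lincomb v y = 0" if "lincomb u y = [:0, 1:] * lincomb v y" "\<And>i. degree (y i) \<le> d" for y
    proof (rule ccontr)
      assume "lincomb v y \<noteq> 0"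
      then have "degree ([:0, 1:] * lincomb v y) > 0" by (simp add: degree_pCons_eq)
      then show False using degree_lincomb[of y d u, OF that(2)] \<open>d = 0\<close> unfolding that(1) by simp
    qed
    then have "lincomb v a = 0" "lincomb v b = 0" using ua ub deg by blast+
    then show False using D by simp
  qed
  ultimately have "d = Suc (d - 1)" "degree (lincomb v a) \<le> d - 1" "degree (lincomb v b) \<le> d - 1" by simp_all
  then show thesis using basis D by (rule that)
qed

lemma degree_minor:
  assumes "degree A \<le> e" "degree B \<le> e"
  shows "degree (A * b k - a k * B) \<le> e + d"
proof (rule degree_diff_le)
  show "degree (A * b k) \<le> e + d"
    by (rule order.trans[OF degree_mult_le add_mono[OF assms(1) deg(2)]])
  show "degree (a k * B) \<le> e + d"
    using order.trans[OF degree_mult_le add_mono[OF deg(1) assms(2)]] by (simp add: add.commute)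
qed

text \<open>
  Let \<open>A\<close>, \<open>B\<close> be the coefficients of \<open>h\<close>, and let \<open>D\<close> be the determinant of \<open>h\<close> and $g = f_k$. By Cramer's
  rule a form \<open>P\<close> with coefficients \<open>A'\<close>, \<open>B'\<close> satisfies $D P = N_1 h - N_2 g$. The point is that \<open>D\<close>
  divides $N_1$ and $N_2$, also at infinity. For this the first pair of variables is replaced by
  \<open>(V, - U)\<close>, where $h + \mu g$ has the coefficients \<open>U\<close>, \<open>V\<close>, with a new variable \<open>\<mu>\<close>. This kills
  $h + \mu g$, and it sends \<open>h\<close> and \<open>g\<close>, hence the base ideal, to multiples of \<open>D\<close>. The image of \<open>P\<close> has
  the coefficients $N_2$ and $N_1$. Powers of \<open>U\<close> and \<open>V\<close> multiply it into the multiples of \<open>D\<close>, and no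
  prime divides both \<open>U\<close> and \<open>V\<close>, so it is itself a multiple of \<open>D\<close>.
\<close>

lemma saturated_of_linear_syzygy:
  assumes fin: "zero_scheme_finite (base_ideal f)"
  shows "component bideg (1, d) (base_ideal f)
    = component bideg (1, d) (saturation (base_ideal f) irrelevant_x)"
proof
  show "component bideg (1, d) (base_ideal f) \<subseteq> component bideg (1, d) (saturation (base_ideal f) irrelevant_x)"
    using subset_saturation[OF is_ideal_base_ideal] by (auto simp: component_def)
next
  obtain k e r s t where d: "d = Suc e"
    and dA: "degree (lincomb v a) \<le> e" and dB: "degree (lincomb v b) \<le> e"
    and basis: "\<And>l y. y l = smult (r l) (lincomb u y) + smult (s l) (lincomb v y) + smult (t l) (y k)"
    and nz: "lincomb v a * b k - a k * lincomb v b \<noteq> 0"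
    by (rule normal_form) blast
  have ua: "lincomb u a = [:0, 1:] * lincomb v a" and ub: "lincomb u b = [:0, 1:] * lincomb v b"
    using syz by (auto simp: linear_syzygy_def)
  define A B where "A = lincomb v a" and "B = lincomb v b"
  define D where "D = A * b k - a k * B"
  have D: "D \<noteq> 0" using nz by (simp add: A_def B_def D_def)
  have pa: "a l = [:s l, r l:] * A + smult (t l) (a k)" for l
    using basis[of a l] unfolding ua A_def[symmetric] by (simp add: algebra_simps)
  have pb: "b l = [:s l, r l:] * B + smult (t l) (b k)" for l
    using basis[of b l] unfolding ub B_def[symmetric] by (simp add: algebra_simps)
  have degAB: "degree A \<le> e" "degree B \<le> e" using dA dB by (simp_all add: A_def B_def)
  have degD: "degree D \<le> e + d"
    unfolding D_def by (rule degree_minor[OF degAB])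
  show "component bideg (1, d) (saturation (base_ideal f) irrelevant_x) \<subseteq> component bideg (1, d) (base_ideal f)"
  proof
    fix P assume "P \<in> component bideg (1, d) (saturation (base_ideal f) irrelevant_x)"
    then have homogP: "homog bideg (1, d) P" and satP: "P \<in> saturation (base_ideal f) irrelevant_x"
      by (auto simp: component_def)
    obtain A' B' where deg': "degree A' \<le> d" "degree B' \<le> d" and P: "P = xform d A' B'"
      using xform_of_homog[OF homogP] by blast
    obtain n where n: "\<And>g. g \<in> ideal_pow irrelevant_x n \<Longrightarrow> P * g \<in> base_ideal f"
      using satP by (auto simp: saturation_def colon_def)
    define N1 N2 where "N1 = b k * A' - a k * B'" and "N2 = B * A' - A * B'"
    have degN: "degree N1 \<le> d + d" "degree N2 \<le> e + d"
      unfolding N1_def N2_def using degAB deg deg'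
      by (intro degree_diff_le order.trans[OF degree_mult_le] add_mono; simp)+
    \<comment> \<open>The divisibility in one chart of the second projective line; \<open>w\<close> is the variable set to 1.\<close>
    have chart: "bform (\<lambda>c. [:c:]) (e + d) D y0 y1 dvd bform (\<lambda>c. [:c:]) (d + d) N1 y0 y1 \<and>
        bform (\<lambda>c. [:c:]) (e + d) D y0 y1 dvd bform (\<lambda>c. [:c:]) (e + d) N2 y0 y1"
      if chart: "(y0, y1, w) \<in> {([:0, 1:], 1, X21), (1, [:0, 1:], X20)}"
        and Dy: "bform (\<lambda>c. [:c:]) (e + d) D y0 y1 \<noteq> 0" for y0 y1 w
    proof -
      note hom = coeff_hom_const_poly[where 'a = 'k]
      define h where "h n p = bform (\<lambda>c. [:c:]) n p y0 y1" for n and p :: "'k poly"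
      define \<kappa> :: "'k \<Rightarrow> 'k poly poly" where "\<kappa> = (\<lambda>c. [:[:c:]:])"
      have \<kappa>: "coeff_hom \<kappa>" unfolding \<kappa>_def by (intro coeff_hom_pCons coeff_hom_const_poly)
      have bform_\<kappa>: "bform \<kappa> n p [:y0:] [:y1:] = [:h n p:]" for n p
        using bform_hom[OF coeff_hom_const_poly, of "\<lambda>c. [:c:]" n p y0 y1] by (simp add: \<kappa>_def h_def)
      \<comment> \<open>Polynomials in \<open>\<mu>\<close> over the ring of polynomials in \<open>Y\<close>.\<close>
      define U V where "U = [:h e A, h d (a k):]" and "V = [:h e B, h d (b k):]"
      define \<sigma> where "\<sigma> = case_xvar V (- U) [:y0:] [:y1:]"
      define \<psi> where "\<psi> = ev \<kappa> \<sigma>"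
      have \<psi>: "coeff_hom \<psi>" unfolding \<psi>_def by (rule coeff_hom_ev[OF \<kappa>])
      have \<psi>_form: "\<psi> (xform d p q) = V * [:h d p:] - U * [:h d q:]" for p q
        unfolding \<psi>_def ev_form[OF \<kappa>] by (simp add: form_def \<sigma>_def bform_\<kappa>)
      have hD: "h (e + d) D = h e A * h d (b k) - h d (a k) * h e B"
      proof -
        have "h (e + d) D = h (e + d) (A * b k) - h (d + e) (a k * B)"
          unfolding h_def D_def by (simp add: bform_diff[OF hom] add.commute)
        then show ?thesis unfolding h_def
          using bform_mult[OF hom degAB(1) deg(2)] bform_mult[OF hom deg(1) degAB(2)] by simp
      qed
      have hN1: "h (d + d) N1 = h d (b k) * h d A' - h d (a k) * h d B'"
        unfolding h_def N1_def
        by (simp only: bform_diff[OF hom] bform_mult[OF hom deg(2) deg'(1)] bform_mult[OF hom deg(1) deg'(2)])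
      have hN2: "h (e + d) N2 = h e B * h d A' - h e A * h d B'"
        unfolding h_def N2_def
        by (simp only: bform_diff[OF hom] bform_mult[OF hom degAB(2) deg'(1)] bform_mult[OF hom degAB(1) deg'(2)])
      have h_split: "h d ([:s l, r l:] * p + smult (t l) q) = h 1 [:s l, r l:] * h e p + [:t l:] * h d q"
        if "degree p \<le> e" for l p q
        using bform_mult[OF hom _ that, of "[:s l, r l:]" 1 y0 y1]
        by (simp only: h_def bform_add[OF hom] bform_smult[OF hom] d) (simp add: degree_pCons_le)
      have ha: "h d (a l) = h 1 [:s l, r l:] * h e A + [:t l:] * h d (a k)" for l
        by (subst pa) (rule h_split[OF degAB(1)])
      have hb: "h d (b l) = h 1 [:s l, r l:] * h e B + [:t l:] * h d (b k)" for l
        by (subst pb) (rule h_split[OF degAB(2)])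
      let ?D = "h (e + d) D"
      have "\<psi> (f l) = [:?D:] * [:- [:t l:], h 1 [:s l, r l:]:]" for l
      proof -
        have "coeff (\<psi> (f l)) m = coeff ([:?D:] * [:- [:t l:], h 1 [:s l, r l:]:]) m" for m
          unfolding f \<psi>_form ha[of l] hb[of l] hD U_def V_def
          by (cases m) (simp_all add: coeff_pCons algebra_simps split: nat.split)
        then show ?thesis by (rule poly_eqI)
      qed
      then have "\<psi> (f l) \<in> {x. [:?D:] dvd x}" for l by (simp only: mem_Collect_eq dvd_triv_left)
      then have I: "base_ideal f \<subseteq> {p. \<psi> p \<in> {x. [:?D:] dvd x}}"
        unfolding base_ideal_def by (intro ideal_minimal is_ideal_vimage[OF \<psi>] is_ideal_multiples) auto
      have w: "w \<in> {X20, X21}" "\<psi> (Var w) = 1"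
        using chart by (auto simp: \<psi>_def ev_Var[OF \<kappa>] \<sigma>_def one_pCons)
      have dvd: "[:?D:] dvd \<psi> (Var x) ^ n * \<psi> P" if "x \<in> {X10, X11}" for x
      proof -
        have "P * (Var x * Var w) ^ n \<in> base_ideal f"
          by (intro n power_in_ideal_pow xy_in_irrelevant_x that w)
        then have "[:?D:] dvd \<psi> (P * (Var x * Var w) ^ n)" using I by blast
        then show ?thesis
          by (simp add: coeff_homD[OF \<psi>] coeff_hom_power[OF \<psi>] w mult.commute)
      qed
      have "[:?D:] dvd \<psi> P"
      proof (rule const_dvd_cancel_powers)
        show "?D \<noteq> 0" using Dy by (simp add: h_def)
        show "[:?D:] dvd \<psi> (Var X10) ^ n * \<psi> P" "[:?D:] dvd \<psi> (Var X11) ^ n * \<psi> P"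
          by (rule dvd; simp)+
        fix \<pi> :: "'k poly" assume \<pi>: "prime_elem \<pi>"
        show "\<not> ([:\<pi>:] dvd \<psi> (Var X10) \<and> [:\<pi>:] dvd \<psi> (Var X11))"
        proof
          assume "[:\<pi>:] dvd \<psi> (Var X10) \<and> [:\<pi>:] dvd \<psi> (Var X11)"
          then have "[:\<pi>:] dvd V" "[:\<pi>:] dvd U"
            by (simp_all add: \<psi>_def ev_Var[OF \<kappa>] \<sigma>_def)
          then have div: "\<pi> dvd coeff V m" "\<pi> dvd coeff U m" for m
            by (simp_all add: const_poly_dvd_iff)
          have "\<pi> dvd h e A" "\<pi> dvd h d (a k)" "\<pi> dvd h e B" "\<pi> dvd h d (b k)"
            using div(1)[of 0] div(1)[of 1] div(2)[of 0] div(2)[of 1] by (simp_all add: U_def V_def)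
          then have "\<pi> dvd h d (a l)" "\<pi> dvd h d (b l)" for l
            unfolding ha[of l] hb[of l] by (simp_all only: dvd_add dvd_mult)
          then have "\<pi> dvd 1"
            using finite_zero_scheme_no_common_factor[OF fin f chart] unfolding h_def by blast
          then show False using \<pi> by (simp add: prime_elem_not_unit)
        qed
      qed
      then have "?D dvd coeff (\<psi> P) 0" "?D dvd coeff (\<psi> P) 1"
        by (simp_all only: const_poly_dvd_iff)
      then show ?thesis
        unfolding P \<psi>_form U_def V_def h_def[symmetric] hN1 hN2 by (simp add: mult.commute)
    qed
    have degN1: "degree N1 \<le> (e + d) + 1" using degN(1) d by simp
    have "bform (\<lambda>c. [:c:]) (e + d) D [:0, 1:] 1 \<noteq> 0" using D bform_affine[OF degD] by simp
    with chart[of "[:0, 1:]" 1 X21] have "D dvd N1" "D dvd N2"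
      using bform_affine[OF degD] bform_affine[OF degN(1)] bform_affine[OF degN(2)] by simp_all
    then obtain Q1 Q2 where Q: "N1 = D * Q1" "N2 = D * Q2" by (auto simp: dvd_def)
    have "coeff (bform (\<lambda>c. [:c:]) (e + d) D 1 [:0, 1:]) (e + d - degree D) \<noteq> 0"
      using D degD by (subst coeff_bform_at_infinity) auto
    then have "bform (\<lambda>c. [:c:]) (e + d) D 1 [:0, 1:] \<noteq> 0" by auto
    with chart[of 1 "[:0, 1:]" X20]
    have infinity: "bform (\<lambda>c. [:c:]) (e + d) D 1 [:0, 1:] dvd bform (\<lambda>c. [:c:]) (e + d + 1) N1 1 [:0, 1:]"
      "bform (\<lambda>c. [:c:]) (e + d) D 1 [:0, 1:] dvd bform (\<lambda>c. [:c:]) (e + d + 0) N2 1 [:0, 1:]"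
      by (simp_all add: d)
    \<comment> \<open>Comparing the orders at infinity bounds the degrees of the two quotients.\<close>
    have "degree Q1 \<le> 1"
      by (rule degree_quotient_at_infinity[OF D degD Q(1) degN1 infinity(1)])
    then have Q1: "Q1 = [:coeff Q1 0, coeff Q1 1:]"
      by (intro poly_eqI) (auto simp: coeff_pCons coeff_eq_0 split: nat.split)
    have "degree Q2 \<le> 0"
      by (rule degree_quotient_at_infinity[OF D degD Q(2) _ infinity(2)]) (use degN in simp)
    then obtain q2 where Q2: "Q2 = [:q2:]" by (auto elim: degree_eq_zeroE)
    \<comment> \<open>$P = Q_1 h - Q_2 g$ written in terms of the $f_i$.\<close>
    define c where "c i = coeff Q1 0 * v i + coeff Q1 1 * u i - (if i = k then q2 else 0)" for i
    have lincomb_c: "lincomb c y = smult (coeff Q1 0) (lincomb v y) + smult (coeff Q1 1) (lincomb u y) - smult q2 (y k)" for y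
      by (cases k) (simp_all add: lincomb_def c_def sum_zvar smult_add_left smult_diff_left smult_add_right algebra_simps)
    have "D * A' = D * (Q1 * A - Q2 * a k)"
    proof -
      have "D * (Q1 * A - Q2 * a k) = N1 * A - N2 * a k" by (simp add: Q algebra_simps)
      also have "\<dots> = D * A'" by (simp add: N1_def N2_def D_def algebra_simps)
      finally show ?thesis ..
    qed
    then have "A' = Q1 * A - Q2 * a k" using D by simp
    also have "\<dots> = lincomb c a"
      unfolding lincomb_c ua A_def[symmetric] by (subst Q1) (simp add: Q2)
    finally have A': "A' = lincomb c a" .
    have "D * B' = D * (Q1 * B - Q2 * b k)"
    proof -
      have "D * (Q1 * B - Q2 * b k) = N1 * B - N2 * b k" by (simp add: Q algebra_simps)
      also have "\<dots> = D * B'" by (simp add: N1_def N2_def D_def algebra_simps)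
      finally show ?thesis ..
    qed
    then have "B' = Q1 * B - Q2 * b k" using D by simp
    also have "\<dots> = lincomb c b"
      unfolding lincomb_c ub B_def[symmetric] by (subst Q1) (simp add: Q2)
    finally have B': "B' = lincomb c b" .
    have "P = (\<Sum>i\<in>UNIV. Const (c i) * f i)" by (simp add: P A' B' lincomb_f)
    then have "P \<in> base_ideal f" by (auto simp: base_ideal_iff)
    then show "P \<in> component bideg (1, d) (base_ideal f)"
      using homogP by (simp add: component_def)
  qed
qed

text \<open>
  In the coordinates \<open>U\<close>, \<open>V\<close>, \<open>Var k\<close> of the plane that belong to the normal form, \<open>y\<close> is \<open>(U : V)\<close>.
  At this \<open>y\<close> the map takes the values $U h$, $V h$, $f_k$, so \<open>x\<close> is the solution of the linear equation
  $z_k h = f_k$, which gives the first two components of \<open>g\<close>. That the other composite is the identity need only be checked after the injective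
  substitution of \<open>f\<close>.
\<close>

lemma inverse_of_linear_syzygy: "\<exists>g. inverse_rational_map f g"
proof -
  obtain k e r s t where d: "d = Suc e"
    and dA: "degree (lincomb v a) \<le> e" and dB: "degree (lincomb v b) \<le> e"
    and nz: "lincomb v a * b k - a k * lincomb v b \<noteq> 0"
    by (rule normal_form) blast
  have ua: "lincomb u a = [:0, 1:] * lincomb v a" and ub: "lincomb u b = [:0, 1:] * lincomb v b"
    using syz by (auto simp: linear_syzygy_def)
  note \<kappa> = coeff_hom_Const[where 'a = 'k and 'b = xvar]
  note \<kappa>z = coeff_hom_Const[where 'a = 'k and 'b = zvar]
  define U V :: "(zvar, 'k) mpoly" where "U = (\<Sum>i\<in>UNIV. Const (u i) * Var i)"
    and "V = (\<Sum>i\<in>UNIV. Const (v i) * Var i)"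
  define g where "g = case_xvar (bform Const d (b k) U V - Var k * bform Const e (lincomb v b) U V)
    (Var k * bform Const e (lincomb v a) U V - bform Const d (a k) U V) U V"
  define H where "H = xform e (lincomb v a) (lincomb v b)"
  define D where "D = bform Const (e + d) (lincomb v a * b k - a k * lincomb v b) (Var X20) (Var X21 :: (xvar, 'k) mpoly)"
  have U: "subst f U = Var X20 * H"
  proof -
    have "subst f U = xform d (lincomb u a) (lincomb u b)"
      by (simp add: U_def subst_eq_ev ev_simps[OF \<kappa>] lincomb_f)
    then show ?thesis
      unfolding H_def form_X_mult[OF \<kappa> dA dB, of Var] by (simp add: ua ub d del: mult_pCons_left)
  qed
  have V: "subst f V = Var X21 * H"
  proof -
    have "subst f V = xform d (lincomb v a) (lincomb v b)"
      by (simp add: V_def subst_eq_ev ev_simps[OF \<kappa>] lincomb_f)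
    then show ?thesis unfolding H_def form_Suc[OF \<kappa> dA dB, of Var] by (simp add: d)
  qed
  have bform_UV: "subst f (bform Const m p U V) = H ^ m * bform Const m p (Var X20) (Var X21)" for m p
    using bform_scale[OF \<kappa>, of m p H "Var X20" "Var X21"] U V
    by (simp add: subst_eq_ev ev_bform[OF \<kappa>] mult.commute)
  let ?bf = "\<lambda>m p. bform Const m p (Var X20) (Var X21 :: (xvar, 'k) mpoly)"
  have D_eq: "D = ?bf e (lincomb v a) * ?bf d (b k) - ?bf d (a k) * ?bf e (lincomb v b)"
    using bform_mult[OF \<kappa> dA deg(2)[of k], of "Var X20" "Var X21"]
      bform_mult[OF \<kappa> deg(1)[of k] dB, of "Var X20" "Var X21"]
    by (simp add: D_def bform_diff[OF \<kappa>] add.commute)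
  have fk: "f k = Var X10 * ?bf d (a k) + Var X11 * ?bf d (b k)" by (simp add: f form_def)
  have H: "H = Var X10 * ?bf e (lincomb v a) + Var X11 * ?bf e (lincomb v b)" by (simp add: H_def form_def)
  have subst_Var_k: "subst f (Var k) = f k" by (simp add: subst_eq_ev ev_Var[OF \<kappa>])
  have g10: "subst f (g X10) = (H ^ e * D) * Var X10"
  proof -
    have "subst f (g X10) = H ^ d * ?bf d (b k) - f k * (H ^ e * ?bf e (lincomb v b))"
      using subst_Var_k bform_UV by (simp add: g_def subst_eq_ev ev_diff[OF \<kappa>] ev_mult[OF \<kappa>])
    also have "\<dots> = H ^ e * (H * ?bf d (b k) - f k * ?bf e (lincomb v b))"
      by (simp add: d algebra_simps)
    also have "H * ?bf d (b k) - f k * ?bf e (lincomb v b) = D * Var X10"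
      unfolding D_eq H fk by (simp add: algebra_simps)
    finally show ?thesis by (simp add: mult.assoc)
  qed
  have g11: "subst f (g X11) = (H ^ e * D) * Var X11"
  proof -
    have "subst f (g X11) = f k * (H ^ e * ?bf e (lincomb v a)) - H ^ d * ?bf d (a k)"
      using subst_Var_k bform_UV by (simp add: g_def subst_eq_ev ev_diff[OF \<kappa>] ev_mult[OF \<kappa>])
    also have "\<dots> = H ^ e * (f k * ?bf e (lincomb v a) - H * ?bf d (a k))"
      by (simp add: d algebra_simps)
    also have "f k * ?bf e (lincomb v a) - H * ?bf d (a k) = D * Var X11"
      unfolding D_eq H fk by (simp add: algebra_simps)
    finally show ?thesis by (simp add: mult.assoc)
  qed
  have g2: "subst f (g X20) = H * Var X20" "subst f (g X21) = H * Var X21"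
    using U V by (simp_all add: g_def mult.commute)
  have "D \<noteq> 0"
  proof
    assume "D = 0"
    let ?p = "lincomb v a * b k - a k * lincomb v b"
    have degp: "degree ?p \<le> e + d" by (rule degree_minor[OF dA dB])
    have "xform (e + d) ?p 0 = xform (e + d) 0 0"
      using \<open>D = 0\<close> by (simp add: form_def D_def bform_0[OF \<kappa>])
    then have "?p = 0" using xform_inject(1)[OF degp, of 0 0 0] by simp
    with nz show False by simp
  qed
  moreover have "H \<noteq> 0"
  proof
    assume "H = 0"
    then have "xform e (lincomb v a) (lincomb v b) = xform e 0 0"
      by (simp add: H_def form_def bform_0[OF \<kappa>])
    then have "lincomb v a = 0" "lincomb v b = 0" using xform_inject[OF dA dB, of 0 0] by simp_all
    with nz show False by simp
  qed
  ultimately have nz': "H \<noteq> 0" "H ^ e * D \<noteq> 0" by simp_all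
  have subst_0: "subst f 0 = 0" by (simp add: subst_eq_ev ev_0[OF \<kappa>])
  have g_nz: "g w \<noteq> 0" for w
    using g10 g11 g2 nz' Var_neq_0[of X10, where 'k = 'k] Var_neq_0[of X11, where 'k = 'k]
      Var_neq_0[of X20, where 'k = 'k] Var_neq_0[of X21, where 'k = 'k] subst_0
    by (cases w) (metis mult_eq_0_iff)+
  have lin: "homog tdeg 1 U" "homog tdeg 1 V"
    unfolding U_def V_def
    by (intro homog_sum; metis homog_mult[OF additive_tdeg homog_Const[OF additive_tdeg] homog_Var_tdeg] add_0)+
  have "homog tdeg d (g X10)" "homog tdeg d (g X11)"
    unfolding g_def using homog_mult[OF additive_tdeg homog_Var_tdeg[of k] homog_bform[OF lin, of e]] homog_bform[OF lin, of d]
    by (auto intro!: homog_diff simp: d)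
  moreover have "homog tdeg 1 (g X20)" "homog tdeg 1 (g X21)"
    using lin by (simp_all add: g_def)
  ultimately have "rational_map_P2_P1xP1 g"
    unfolding rational_map_P2_P1xP1_def using g_nz by blast
  moreover have "same_coords {X10, X11} (\<lambda>v. subst f (g v)) Var"
    unfolding same_coords_def using nz' Var_neq_0[of X10, where 'k = 'k] by (auto simp: g10 g11)
  moreover have "same_coords {X20, X21} (\<lambda>v. subst f (g v)) Var"
    unfolding same_coords_def using nz' Var_neq_0[of X20, where 'k = 'k] by (auto simp: g2)
  moreover have "same_coords {Z0, Z1, Z2} (\<lambda>i. subst g (f i)) Var"
  proof -
    define E where "E = H ^ e * D * H ^ d"
    have E: "subst f (subst g (f i)) = E * f i" for i
    proof -
      have "subst f (subst g (f i)) = form Const d (a i) (b i) (\<lambda>v. subst f (g v))"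
        unfolding subst_eq_ev[of f] ev_subst[OF \<kappa>] f[of i] ev_form[OF \<kappa>] ..
      also have "\<dots> = E * f i"
        using bform_scale[OF \<kappa>, of d "a i" H "Var X20" "Var X21"] bform_scale[OF \<kappa>, of d "b i" H "Var X20" "Var X21"]
        by (simp add: form_def f g10 g11 g2 E_def algebra_simps)
      finally show ?thesis .
    qed
    have "subst g (f i) * Var j = subst g (f j) * Var i" for i j
    proof -
      have "subst f (subst g (f i) * Var j - subst g (f j) * Var i) = 0"
        using E by (simp add: subst_eq_ev ev_diff[OF \<kappa>] ev_mult[OF \<kappa>] ev_Var[OF \<kappa>])
      then show ?thesis using inj by fastforce
    qed
    moreover have "subst g (f Z0) \<noteq> 0"
    proof
      assume "subst g (f Z0) = 0"
      then have "E * f Z0 = 0" using E[of Z0] subst_0 by simp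
      then have "f Z0 = 0" using nz' by (simp add: E_def)
      then have "subst f (Var Z0) = 0" by (simp add: subst_eq_ev ev_Var[OF \<kappa>])
      then have "Var Z0 = (0 :: (zvar, 'k) mpoly)" by (rule inj)
      then show False by (rule notE[OF Var_neq_0])
    qed
    ultimately show ?thesis
      unfolding same_coords_def using Var_neq_0[of Z0, where 'k = 'k] by blast
  qed
  ultimately show ?thesis unfolding inverse_rational_map_def by blast
qed

end

end

theorem theorem3p16:
  fixes f :: "zvar \<Rightarrow> (xvar, 'k::field) mpoly" and d2 :: nat
  assumes "\<And>i. homog bideg (1, d2) (f i)"
    and "dominant f"
    and "zero_scheme_finite (base_ideal f)"
  shows "birational f \<longleftrightarrow>
    component bideg (1, d2) (base_ideal f) =
    component bideg (1, d2) (saturation (base_ideal f) irrelevant_x)"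
proof -
  have "\<exists>a b. degree a \<le> d2 \<and> degree b \<le> d2 \<and> f i = xform d2 a b" for i
    using xform_of_homog[OF assms(1)] by metis
  then obtain a b where ab: "\<And>i. degree (a i) \<le> d2" "\<And>i. degree (b i) \<le> d2"
    and f: "\<And>i. f i = xform d2 (a i) (b i)"
    by metis
  have inj: "h = 0" if "subst f h = 0" for h
    using subst_injective_of_dominant[OF assms(1,2) that] .
  show ?thesis
  proof
    assume "birational f"
    then obtain g where "inverse_rational_map f g" by (auto simp: birational_def)
    then obtain n where "homog tdeg n (g X20)" "homog tdeg n (g X21)"
      and "same_coords {X20, X21} (\<lambda>v. subst f (g v)) Var"
      by (auto simp: inverse_rational_map_def rational_map_P2_P1xP1_def)
    then obtain u v where "linear_syzygy a b u v"
      using linear_syzygy_of_inverse[where f = f and a = a and b = b and d = d2] f ab inj by blast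
    then show "component bideg (1, d2) (base_ideal f) =
        component bideg (1, d2) (saturation (base_ideal f) irrelevant_x)"
      using saturated_of_linear_syzygy[where f = f and a = a and b = b and d = d2] f ab inj assms(3) by blast
  next
    assume "component bideg (1, d2) (base_ideal f) =
      component bideg (1, d2) (saturation (base_ideal f) irrelevant_x)"
    then obtain u v where "linear_syzygy a b u v"
      using linear_syzygy_of_saturated[where f = f and a = a and b = b and d = d2] f ab inj by blast
    then have "\<exists>g. inverse_rational_map f g"
      using inverse_of_linear_syzygy[where f = f and a = a and b = b and d = d2] f ab inj by blast
    with assms(2) show "birational f" by (simp add: birational_def)
  qed
qed

end
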